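(* For every integer $k\geq 9$, the function $\zeta^k(2s)+\zeta^k(3s)$ has infinitely many zeros in the half-plane $\sigma>1$. On the other hand, for every integer $k$ with $1\leq k\leq 5$, the function $\zeta^k(2s)+\zeta^k(3s)$ has no zeros in the half-plane $\sigma>1$.
   Context: Write $s=\sigma+it$ with $\sigma,t\in\mathbb{R}$. $\zeta$ is the Riemann zeta function, and $\zeta^k(js)$ denotes the $k$-th power $(\zeta(js))^k$. *)

theory Defs
  imports "HOL-Complex_Analysis.Complex_Analysis"
begin

definition zeta_series :: "complex \<Rightarrow> complex" where
  "zeta_series s = (\<Sum>n. 1 / of_nat (Suc n) powr s)"

(* The Dirichlet series where it converges absolutely, and its (unique) analytic
   continuation to the rest of the plane minus {1}.  The value at the pole s = 1
   is unspecified. *)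
definition zeta :: "complex \<Rightarrow> complex" where
  "zeta s = (if Re s > 1 then zeta_series s
             else (SOME f. f holomorphic_on (- {1}) \<and> (\<forall>z. Re z > 1 \<longrightarrow> f z = zeta_series z)) s)"

end

theory Submission
  imports Defs
begin

text \<open>
  Where \<open>\<zeta>(3s)\<close> does not vanish, \<open>\<zeta>(2s)^k + \<zeta>(3s)^k = 0\<close> says that the quotient \<open>\<zeta>(2s) / \<zeta>(3s)\<close> is a \<open>k\<close>-th root
  of \<open>-1\<close>.  By the Euler product this quotient is the product over all primes of \<open>1 + x^2 / (1 + x)\<close>
  with \<open>x = p powr -s\<close>, and \<open>|x| < 1 / p\<close> when \<open>\<sigma> > 1\<close>.  The question is therefore which arguments
  such a product can have.

  For \<open>k \<le> 5\<close> the answer is that they are too small.  The maximal arguments of the individual factors over the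
  discs \<open>|x| \<le> 1 / p\<close> add up to less than \<open>pi / 5\<close> (\<open>sum_arg_bound_le\<close>, \<open>total_arg_bound_less\<close>), whereas a \<open>k\<close>-th root of \<open>-1\<close> has
  an argument of modulus at least \<open>pi / k\<close>.  The sum is about \<open>0.62\<close> against \<open>pi / 5 = 0.628...\<close>, so
  the four smallest primes need nearly sharp bounds and the rest needs a careful tail estimate.

  For \<open>k \<ge> 9\<close> and \<open>\<sigma>\<close> slightly above \<open>1\<close>, phases \<open>\<omega> p\<close> on the unit circle are found for which the product with
  \<open>x = \<omega> p * p powr -\<sigma>\<close> is exactly \<open>cis (pi / k)\<close> (\<open>euler_ratio_attains\<close>, \<open>eventually_attains\<close>).  Two real equations have to be
  solved, but the equation for the factor at \<open>2\<close> is quadratic in \<open>x\<close>: whatever the other factors are, it has complex solutions, and only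
  the modulus of a solution must be right.  That is one real condition, which the intermediate value theorem
  settles by moving the phases at \<open>3, 5, 7\<close>.

  Finally, the logarithms of the primes are linearly independent over the integers, so by Kronecker's theorem
  vertical shifts of the true quotient converge to the quotient twisted by \<open>\<omega>\<close>, and Hurwitz's theorem
  produces points with real part arbitrarily close to \<open>\<sigma>\<close> at which the true quotient equals \<open>cis (pi / k)\<close>
  (\<open>zeta_ratio_attains_nearby\<close>).  As \<open>\<sigma>\<close> ranges over an interval, infinitely many zeros arise.
\<close>

section \<open>The Euler product\<close>

definition primes_below :: "nat \<Rightarrow> nat set" where
  "primes_below N = {p\<in>{..<N}. prime p}"

lemma finite_primes_below [simp]: "finite (primes_below N)"
  by (simp add: primes_below_def)

lemma primes_below_Suc:
  "primes_below (Suc N) = (if prime N then insert N (primes_below N) else primes_below N)"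
  by (auto simp: primes_below_def less_Suc_eq)

lemma not_mem_primes_below [simp]: "N \<notin> primes_below N"
  by (simp add: primes_below_def)

text \<open>Sieving: multiplying by \<open>1 - f p\<close> removes from the sum exactly the multiples of \<open>p\<close>, so after all
  primes below \<open>N\<close> only \<open>1\<close> and some integers \<open>\<ge> N\<close> are left, and absolute convergence makes these negligible.
  The statement avoids division, and shows in passing that the sum is not \<open>0\<close>.\<close>
lemma euler_product:
  fixes f :: "nat \<Rightarrow> complex"
  assumes f1: "f 1 = 1" and mult: "\<And>m n. f (m * n) = f m * f n"
    and summ: "f summable_on {1..}"
  shows "(\<lambda>N. (\<Prod>p\<in>primes_below N. 1 - f p) * infsum f {1..}) \<longlonglongrightarrow> 1"
proof -
  define A where "A N = {n. n \<ge> 1 \<and> (\<forall>p. prime p \<and> p < N \<longrightarrow> \<not> p dvd n)}" for N :: nat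
  have sub: "A N \<subseteq> {1..}" for N by (auto simp: A_def)
  have summA: "f summable_on B" if "B \<subseteq> {1..}" for B
    using summable_on_subset_banach[OF summ that] .
  \<comment> \<open>\<open>A N\<close> is what survives the sieve by the primes below \<open>N\<close>\<close>
  have sieve: "(\<Prod>p\<in>primes_below N. 1 - f p) * infsum f {1..} = infsum f (A N)" for N
  proof (induction N)
    case 0
    have "A 0 = {1..}" by (auto simp: A_def)
    then show ?case by (simp add: primes_below_def)
  next
    case (Suc N)
    show ?case
    proof (cases "prime N")
      case False
      then have "A (Suc N) = A N" by (auto simp: A_def less_Suc_eq)
      with False Suc show ?thesis by (simp add: primes_below_Suc)
    next
      case True
      have "N > 0" using True prime_gt_0_nat by blast
      have split: "A N = A (Suc N) \<union> (*) N ` A N"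
      proof (intro equalityI subsetI)
        fix n assume n: "n \<in> A N"
        show "n \<in> A (Suc N) \<union> (*) N ` A N"
        proof (cases "N dvd n")
          case True
          then obtain m where m: "n = N * m" by blast
          with n have "m \<in> A N" by (auto simp: A_def)
          with m show ?thesis by blast
        next
          case False
          with n show ?thesis by (auto simp: A_def less_Suc_eq)
        qed
      next
        fix n assume "n \<in> A (Suc N) \<union> (*) N ` A N"
        then show "n \<in> A N"
        proof
          assume "n \<in> (*) N ` A N"
          then obtain m where m: "n = N * m" "m \<in> A N" by blast
          have "\<not> p dvd N" if "prime p" "p < N" for p
            using that True by (metis less_irrefl primes_dvd_imp_eq)
          with m \<open>N > 0\<close> show "n \<in> A N"
            by (auto simp: A_def prime_dvd_mult_iff)
        qed (auto simp: A_def)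
      qed
      have disj: "A (Suc N) \<inter> (*) N ` A N = {}"
        using True by (auto simp: A_def)
      have img: "(*) N ` A N \<subseteq> {1..}"
        using \<open>N > 0\<close> by (auto simp: A_def)
      have "infsum f (A N) = infsum f (A (Suc N)) + infsum f ((*) N ` A N)"
        by (subst split, rule infsum_Un_disjoint) (use summA sub img disj in auto)
      also have "infsum f ((*) N ` A N) = infsum (f \<circ> (*) N) (A N)"
        by (rule infsum_reindex) (use \<open>N > 0\<close> in \<open>auto simp: inj_on_def\<close>)
      also have "\<dots> = f N * infsum f (A N)"
        by (simp add: o_def mult infsum_cmult_right')
      finally have "infsum f (A (Suc N)) = infsum f (A N) - f N * infsum f (A N)"
        by (metis add_diff_cancel_right')
      then have "infsum f (A (Suc N)) = (1 - f N) * infsum f (A N)"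
        by (simp add: left_diff_distrib)
      with True Suc show ?thesis by (simp add: primes_below_Suc mult.assoc)
    qed
  qed
  have absum: "(\<lambda>n. norm (f n)) summable_on {1..}"
    using summ by (simp add: summable_on_iff_abs_summable_on_complex)
  have "summable (\<lambda>n. norm (f (Suc n)))"
  proof -
    have "(\<lambda>n. norm (f n)) summable_on (Suc ` UNIV)"
      using absum by (rule summable_on_subset_banach) auto
    then have "(\<lambda>n. norm (f (Suc n))) summable_on UNIV"
      by (subst (asm) summable_on_reindex) (auto simp: o_def)
    then show ?thesis by (rule summable_on_UNIV_nonneg_real_iff[THEN iffD1, rotated]) auto
  qed
  have bound: "norm (infsum f (A (Suc N)) - 1) \<le> (\<Sum>n. norm (f (Suc (n + N))))" for N
  proof -
    have "1 \<in> A (Suc N)" by (auto simp: A_def)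
    have big: "A (Suc N) - {1} \<subseteq> {Suc N..}"
    proof
      fix n assume n: "n \<in> A (Suc N) - {1}"
      then have "n \<noteq> 1" "n \<ge> 1" by (auto simp: A_def)
      then obtain p where p: "prime p" "p dvd n" using prime_factor_nat by blast
      with n have "\<not> p < Suc N" by (auto simp: A_def)
      moreover have "p \<le> n" using p \<open>n \<ge> 1\<close> by (intro dvd_imp_le) auto
      ultimately show "n \<in> {Suc N..}" by auto
    qed
    have "infsum f (A (Suc N)) = infsum f (insert 1 (A (Suc N) - {1}))"
      using \<open>1 \<in> A (Suc N)\<close> by (simp add: insert_absorb)
    also have "\<dots> = 1 + infsum f (A (Suc N) - {1})"
      by (subst infsum_insert) (use f1 summA sub in \<open>auto simp: Diff_subset_conv subset_insertI2\<close>)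
    finally have "norm (infsum f (A (Suc N)) - 1) = norm (infsum f (A (Suc N) - {1}))" by simp
    also have "\<dots> \<le> infsum (\<lambda>n. norm (f n)) (A (Suc N) - {1})"
      by (rule norm_infsum_bound, rule summable_on_subset_banach[OF absum])
         (use sub in auto)
    also have "\<dots> \<le> infsum (\<lambda>n. norm (f n)) {Suc N..}"
      by (rule infsum_mono_neutral)
         (use big in \<open>auto intro!: summable_on_subset_banach[OF absum] simp: A_def\<close>)
    also have "{Suc N..} = (\<lambda>n. Suc (n + N)) ` UNIV"
      using image_add_atLeast[of "Suc N" 0] by (simp add: add.commute)
    also have "infsum (\<lambda>n. norm (f n)) \<dots> = infsum (\<lambda>n. norm (f (Suc (n + N)))) UNIV"
      by (subst infsum_reindex) (auto simp: inj_on_def o_def)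
    also have "\<dots> = (\<Sum>n. norm (f (Suc (n + N))))"
    proof -
      have "summable (\<lambda>n. norm (f (Suc (n + N))))"
        using \<open>summable (\<lambda>n. norm (f (Suc n)))\<close> summable_iff_shift[of "\<lambda>n. norm (f (Suc n))" N] by simp
      then have "(\<lambda>n. norm (f (Suc (n + N)))) summable_on UNIV"
        by (intro norm_summable_imp_summable_on) auto
      then show ?thesis
        by (intro sums_unique has_sum_imp_sums has_sum_infsum)
    qed
    finally show ?thesis .
  qed
  have "(\<lambda>N. \<Sum>n. norm (f (Suc (n + N)))) \<longlonglongrightarrow> 0"
  proof (rule LIMSEQ_I)
    fix r :: real assume "r > 0"
    from suminf_exist_split[OF this \<open>summable (\<lambda>n. norm (f (Suc n)))\<close>]
    show "\<exists>no. \<forall>n\<ge>no. norm ((\<Sum>na. norm (f (Suc (na + n)))) - 0) < r" by simp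
  qed
  then have "(\<lambda>N. infsum f (A (Suc N)) - 1) \<longlonglongrightarrow> 0"
    by (rule Lim_null_comparison[rotated]) (use bound in simp)
  then have "(\<lambda>N. infsum f (A (Suc N))) \<longlonglongrightarrow> 1" by (simp add: LIM_zero_iff)
  then have "(\<lambda>N. infsum f (A N)) \<longlonglongrightarrow> 1" by (subst (asm) filterlim_sequentially_Suc)
  then show ?thesis unfolding sieve .
qed

lemma zeta_euler_product:
  assumes "Re s > 1"
  shows "(\<lambda>N. (\<Prod>p\<in>primes_below N. 1 - of_nat p powr (- s)) * zeta s) \<longlonglongrightarrow> 1"
proof -
  define f where "f = (\<lambda>n::nat. of_nat n powr (- s) :: complex)"
  have nf: "norm (f n) = real n powr (- Re s)" for n
    by (cases "n = 0") (auto simp: f_def norm_powr_real_powr)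
  have "summable (\<lambda>n. norm (f n))"
    unfolding nf using assms by (subst summable_real_powr_iff) auto
  then have sumU: "f summable_on UNIV" by (rule norm_summable_imp_summable_on)
  then have summ: "f summable_on {1..}" by (rule summable_on_subset_banach) auto
  have "infsum f {1..} = infsum f (Suc ` UNIV)"
    by (metis One_nat_def atLeast_Suc_greaterThan greaterThan_0)
  also have "\<dots> = infsum (f \<circ> Suc) UNIV" by (rule infsum_reindex) auto
  also have "\<dots> = (\<Sum>n. f (Suc n))"
  proof -
    have "f summable_on (Suc ` UNIV)" using sumU by (rule summable_on_subset_banach) auto
    then have "(f \<circ> Suc) summable_on UNIV" by (subst (asm) summable_on_reindex) auto
    from sums_unique[OF has_sum_imp_sums[OF has_sum_infsum[OF this]]]
    show ?thesis by (simp add: o_def)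
  qed
  also have "\<dots> = zeta s"
    using assms unfolding zeta_def zeta_series_def f_def
    by (simp add: powr_minus divide_inverse del: of_nat_Suc)
  finally have "infsum f {1..} = zeta s" .
  moreover have "f (m * n) = f m * f n" for m n
    unfolding f_def by (simp add: powr_times_real)
  moreover have "f 1 = 1" by (simp add: f_def)
  ultimately show ?thesis using euler_product[of f] summ by (simp add: f_def)
qed

section \<open>The zeta quotient as a function of independent prime values\<close>

text \<open>The contribution \<open>(1 - x^3) / (1 - x^2)\<close> of one prime to \<open>\<zeta>(2s) / \<zeta>(3s)\<close>, where \<open>x = p powr -s\<close>, with the common
  factor \<open>1 - x\<close> cancelled.  In this form it is \<open>1\<close> plus a term of size about \<open>|x|^2\<close>.\<close>
definition local_factor :: "complex \<Rightarrow> complex" where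
  "local_factor x = 1 + x\<^sup>2 / (1 + x)"

text \<open>The values at the primes are treated as independent variables \<open>x p\<close>.  The bound \<open>1 / p\<close> is the value of
  \<open>|p powr -s|\<close> on the line \<open>\<sigma> = 1\<close>; it makes all convergence statements uniform in \<open>x\<close>.\<close>
definition admissible :: "(nat \<Rightarrow> complex) set" where
  "admissible = {x. \<forall>p. prime p \<longrightarrow> norm (x p) \<le> 1 / real p}"

definition partial_ratio :: "nat \<Rightarrow> (nat \<Rightarrow> complex) \<Rightarrow> complex" where
  "partial_ratio N x = (\<Prod>p\<in>primes_below N. local_factor (x p))"

definition euler_ratio :: "(nat \<Rightarrow> complex) \<Rightarrow> complex" where
  "euler_ratio x = lim (\<lambda>N. partial_ratio N x)"

lemma one_plus_nonzero: "norm (x :: complex) < 1 \<Longrightarrow> 1 + x \<noteq> 0"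
  by (metis add_eq_0_iff norm_minus_cancel norm_one less_irrefl)

lemma local_factor_eq:
  assumes "norm x < 1"
  shows "local_factor x = (1 - x ^ 3) / (1 - x\<^sup>2)"
proof -
  have "1 + x \<noteq> 0" using assms by (rule one_plus_nonzero)
  moreover have "1 - x \<noteq> 0" using assms by auto
  moreover have "1 - x\<^sup>2 = (1 - x) * (1 + x)" by (simp add: algebra_simps power2_eq_square)
  moreover have "1 - x ^ 3 = (1 - x) * (1 + x + x\<^sup>2)"
    by (simp add: algebra_simps power2_eq_square power3_eq_cube)
  ultimately have "(1 - x ^ 3) / (1 - x\<^sup>2) = (1 + x + x\<^sup>2) / (1 + x)" by simp
  with \<open>1 + x \<noteq> 0\<close> show ?thesis
    by (simp add: local_factor_def add_divide_distrib[of "1 + x"])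
qed

lemma norm_local_factor_minus_1:
  assumes "norm x \<le> r" "r < 1"
  shows "norm (local_factor x - 1) \<le> r\<^sup>2 / (1 - r)"
proof -
  have "1 - r \<le> norm (1 + x)"
    using norm_triangle_ineq2[of 1 "- x"] assms by simp
  then have "norm (x\<^sup>2 / (1 + x)) \<le> r\<^sup>2 / (1 - r)"
    unfolding norm_divide norm_power using assms by (intro frac_le power_mono) auto
  then show ?thesis by (simp add: local_factor_def)
qed

lemma local_factor_admissible:
  assumes "norm x \<le> 1 / real p" "2 \<le> p"
  shows "norm (local_factor x - 1) \<le> 2 / real p ^ 2"
proof -
  have "norm (local_factor x - 1) \<le> (1 / real p)\<^sup>2 / (1 - 1 / real p)"
    using assms by (intro norm_local_factor_minus_1) auto
  also have "\<dots> \<le> (1 / real p)\<^sup>2 / (1 / 2)"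
    using assms by (intro divide_left_mono) (auto simp: field_simps)
  finally show ?thesis by (simp add: power_divide)
qed

lemma continuous_on_local_factor: "continuous_on (ball 0 1) local_factor"
  unfolding local_factor_def
  by (intro continuous_intros) (auto simp: one_plus_nonzero)

lemma holomorphic_on_local_factor: "local_factor holomorphic_on ball 0 1"
  unfolding local_factor_def
  by (intro holomorphic_intros) (auto simp: one_plus_nonzero)

text \<open>One summable majorant, independent of \<open>x\<close>, serves for every product over a set of primes.\<close>
lemma norm_prod_local_factor_minus_1:
  assumes "finite P" "\<And>p. p \<in> P \<Longrightarrow> prime p \<and> norm (x p) \<le> 1 / real p"
  shows "norm ((\<Prod>p\<in>P. local_factor (x p)) - 1) \<le> exp (\<Sum>p\<in>P. 2 / real p ^ 2) - 1"
proof -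
  have "norm ((\<Prod>p\<in>P. local_factor (x p)) - 1)
          = norm ((\<Prod>p\<in>P. 1 + (local_factor (x p) - 1)) - 1)" by simp
  also have "\<dots> \<le> (\<Prod>p\<in>P. 1 + norm (local_factor (x p) - 1)) - 1"
    by (rule norm_prod_minus1_le_prod_minus1)
  also have "\<dots> \<le> (\<Prod>p\<in>P. 1 + 2 / real p ^ 2) - 1"
    using assms
    by (intro diff_right_mono prod_mono) (auto intro!: local_factor_admissible dest: prime_ge_2_nat)
  also have "\<dots> \<le> exp (\<Sum>p\<in>P. 2 / real p ^ 2) - 1"
    by (intro diff_right_mono prod_le_exp_sum) auto
  finally show ?thesis .
qed

lemma uniformly_Cauchy_partial_ratio:
  "uniformly_Cauchy_on admissible partial_ratio"
proof (rule uniformly_Cauchy_onI')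
  define g where "g = (\<lambda>n::nat. 2 / real n ^ 2)"
  have summg: "summable g"
    unfolding g_def using summable_mult[OF inverse_power_summable[of 2], of "2::real"]
    by (simp add: divide_inverse)
  have g0: "g n \<ge> 0" for n by (simp add: g_def)
  define C where "C = exp (suminf g)"
  have "C > 0" by (simp add: C_def)
  have fin: "sum g (primes_below N) \<le> suminf g" for N
    using summg g0 by (intro sum_le_suminf) auto
  have bdd: "norm (partial_ratio N x) \<le> C" if "x \<in> admissible" for N x
  proof -
    have "norm (partial_ratio N x - 1) \<le> exp (sum g (primes_below N)) - 1"
      unfolding partial_ratio_def g_def using that
      by (intro norm_prod_local_factor_minus_1) (auto simp: primes_below_def admissible_def)
    also have "\<dots> \<le> C - 1" using fin by (simp add: C_def)
    finally show ?thesis using norm_triangle_sub[of "partial_ratio N x" 1] by simp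
  qed
  fix e :: real assume "e > 0"
  define d where "d = ln (1 + e / C)"
  have "d > 0" using \<open>e > 0\<close> \<open>C > 0\<close> by (auto simp: d_def intro!: ln_gt_zero)
  from suminf_exist_split[OF this summg] obtain M where M: "\<And>n. n \<ge> M \<Longrightarrow> norm (\<Sum>i. g (i + n)) < d"
    by blast
  show "\<exists>M. \<forall>x\<in>admissible. \<forall>m\<ge>M. \<forall>n>m. dist (partial_ratio m x) (partial_ratio n x) < e"
  proof (intro exI[of _ M] ballI allI impI)
    fix x m n assume x: "x \<in> admissible" and m: "M \<le> m" "m < n"
    define Q where "Q = primes_below n - primes_below m"
    have sub: "primes_below m \<subseteq> primes_below n" using m by (auto simp: primes_below_def)
    have split: "partial_ratio n x = partial_ratio m x * (\<Prod>p\<in>Q. local_factor (x p))"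
      unfolding partial_ratio_def Q_def
      by (subst prod.subset_diff[OF sub]) (simp_all add: mult.commute)
    have "sum g Q \<le> sum g {m..<n}"
      by (rule sum_mono2) (auto simp: Q_def primes_below_def g0)
    also have "\<dots> = sum (\<lambda>i. g (i + m)) {..<n-m}"
      by (rule sum.reindex_bij_witness[of _ "\<lambda>i. i + m" "\<lambda>i. i - m"]) auto
    also have "\<dots> \<le> (\<Sum>i. g (i + m))"
      using summg g0 by (intro sum_le_suminf) auto
    also have "\<dots> < d" using M[OF m(1)] by simp
    finally have "exp (sum g Q) - 1 < e / C"
      using \<open>e > 0\<close> \<open>C > 0\<close> unfolding d_def
      by (smt (verit) divide_pos_pos exp_less_mono exp_ln)
    moreover have "norm ((\<Prod>p\<in>Q. local_factor (x p)) - 1) \<le> exp (sum g Q) - 1"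
      unfolding g_def using x
      by (intro norm_prod_local_factor_minus_1) (auto simp: Q_def primes_below_def admissible_def)
    ultimately have tail: "norm ((\<Prod>p\<in>Q. local_factor (x p)) - 1) < e / C" by linarith
    have "dist (partial_ratio m x) (partial_ratio n x)
            = norm (partial_ratio m x) * norm ((\<Prod>p\<in>Q. local_factor (x p)) - 1)"
      unfolding split dist_norm norm_mult[symmetric]
      by (subst norm_minus_commute) (simp add: algebra_simps)
    also have "\<dots> \<le> C * norm ((\<Prod>p\<in>Q. local_factor (x p)) - 1)"
      by (intro mult_right_mono bdd x) auto
    also have "\<dots> < C * (e / C)"
      using tail \<open>C > 0\<close> by (intro mult_strict_left_mono)
    finally show "dist (partial_ratio m x) (partial_ratio n x) < e" using \<open>C > 0\<close> by simp
  qed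
qed

lemma uniform_limit_partial_ratio:
  "uniform_limit admissible partial_ratio euler_ratio sequentially"
  using Cauchy_uniformly_convergent[OF uniformly_Cauchy_partial_ratio]
  by (simp add: uniformly_convergent_uniform_limit_iff euler_ratio_def[abs_def])

lemma partial_ratio_tendsto:
  "x \<in> admissible \<Longrightarrow> (\<lambda>N. partial_ratio N x) \<longlonglongrightarrow> euler_ratio x"
  using tendsto_uniform_limitI[OF uniform_limit_partial_ratio] .

text \<open>Continuity of the infinite product in its infinitely many variables: a uniformly small tail leaves a finite
  product, for which convergence in each variable is enough.  The parameter \<open>s\<close> is carried along so that the
  conclusion is the locally uniform convergence that Hurwitz's theorem asks for.\<close>
lemma uniform_limit_euler_ratio_compose:
  assumes x: "\<And>n s. s \<in> K \<Longrightarrow> (\<lambda>p. x n s p) \<in> admissible"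
    and y: "\<And>s. s \<in> K \<Longrightarrow> (\<lambda>p. y s p) \<in> admissible"
    and lim: "\<And>p. prime p \<Longrightarrow> uniform_limit K (\<lambda>n s. x n s p) (\<lambda>s. y s p) sequentially"
  shows "uniform_limit K (\<lambda>n s. euler_ratio (x n s)) (\<lambda>s. euler_ratio (y s)) sequentially"
proof (rule uniform_limitI)
  fix e :: real assume "e > 0"
  from uniform_limitD[OF uniform_limit_partial_ratio, of "e / 3"] \<open>e > 0\<close>
  have "\<forall>\<^sub>F N in sequentially. \<forall>x\<in>admissible. dist (partial_ratio N x) (euler_ratio x) < e / 3" by simp
  then obtain N where N: "\<And>x. x \<in> admissible \<Longrightarrow> dist (partial_ratio N x) (euler_ratio x) < e / 3"
    by (auto simp: eventually_sequentially)
  have lf: "uniform_limit K (\<lambda>n s. local_factor (x n s p)) (\<lambda>s. local_factor (y s p)) sequentially"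
    if "prime p" for p
  proof (rule uniform_limit_compose_uniformly_continuous_on[where f = local_factor and B = "cball 0 (1/2)"])
    have in_ball: "z \<in> cball 0 (1/2)" if "norm z \<le> 1 / real p" for z :: complex
    proof -
      have "1 / real p \<le> 1 / 2" using prime_ge_2_nat[OF \<open>prime p\<close>] by (intro divide_left_mono) auto
      with that show ?thesis by simp
    qed
    show "uniform_limit K (\<lambda>n s. x n s p) (\<lambda>s. y s p) sequentially" by (rule lim[OF that])
    show "uniformly_continuous_on (cball 0 (1/2)) local_factor"
      by (intro compact_uniformly_continuous continuous_on_subset[OF continuous_on_local_factor]) auto
    show "\<forall>\<^sub>F n in sequentially. \<forall>s\<in>K. x n s p \<in> cball 0 (1/2)"
    proof (intro always_eventually allI ballI)
      fix n s assume "s \<in> K"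
      then show "x n s p \<in> cball 0 (1/2)"
        using x[of s n] in_ball[of "x n s p"] \<open>prime p\<close> unfolding admissible_def by blast
    qed
    show "closed (cball 0 (1/2 :: real) :: complex set)" by simp
  qed
  have "uniform_limit K (\<lambda>n s. partial_ratio N (x n s)) (\<lambda>s. partial_ratio N (y s)) sequentially"
  proof -
    have "uniform_limit K (\<lambda>n s. \<Prod>p\<in>P. local_factor (x n s p)) (\<lambda>s. \<Prod>p\<in>P. local_factor (y s p)) sequentially
        \<and> bounded ((\<lambda>s. \<Prod>p\<in>P. local_factor (y s p)) ` K)"
      if "finite P" "P \<subseteq> {p. prime p}" for P
      using that
    proof (induction P rule: finite_induct)
      case empty
      then show ?case by (auto intro: uniform_limit_const simp: image_constant_conv)
    next
      case (insert p P)
      then have p: "prime p" by auto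
      have "norm (local_factor (y s p)) \<le> 3" if "s \<in> K" for s
      proof -
        have "norm (local_factor (y s p) - 1) \<le> 2 / real p ^ 2"
          using y[OF that] p by (intro local_factor_admissible) (auto simp: admissible_def prime_ge_2_nat)
        also have "\<dots> \<le> 2 / 1"
          using prime_ge_1_nat[OF p] by (intro divide_left_mono) auto
        finally show ?thesis using norm_triangle_sub[of "local_factor (y s p)" 1] by simp
      qed
      then have bp: "bounded ((\<lambda>s. local_factor (y s p)) ` K)"
        by (auto simp: bounded_iff)
      from insert have IH:
        "uniform_limit K (\<lambda>n s. \<Prod>p\<in>P. local_factor (x n s p)) (\<lambda>s. \<Prod>p\<in>P. local_factor (y s p)) sequentially"
        "bounded ((\<lambda>s. \<Prod>p\<in>P. local_factor (y s p)) ` K)" by auto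
      obtain B1 where B1: "\<And>s. s \<in> K \<Longrightarrow> norm (local_factor (y s p)) \<le> B1"
        using bp by (auto simp: bounded_iff)
      obtain B2 where B2: "\<And>s. s \<in> K \<Longrightarrow> norm (\<Prod>p\<in>P. local_factor (y s p)) \<le> B2"
        using IH(2) by (auto simp: bounded_iff)
      have "norm (local_factor (y s p) * (\<Prod>p\<in>P. local_factor (y s p))) \<le> B1 * B2" if "s \<in> K" for s
        unfolding norm_mult using B1[OF that] B2[OF that]
        by (intro mult_mono) (auto intro: order_trans[OF norm_ge_zero])
      then have "bounded ((\<lambda>s. local_factor (y s p) * (\<Prod>p\<in>P. local_factor (y s p))) ` K)"
        by (auto simp: bounded_iff)
      with uniform_lim_mult[OF lf[OF p] IH(1) bp IH(2)] insert.hyps show ?case by simp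
    qed
    then show ?thesis unfolding partial_ratio_def by (auto simp: primes_below_def)
  qed
  from uniform_limitD[OF this, of "e / 3"] \<open>e > 0\<close>
  have "\<forall>\<^sub>F n in sequentially. \<forall>s\<in>K. dist (partial_ratio N (x n s)) (partial_ratio N (y s)) < e / 3" by simp
  then show "\<forall>\<^sub>F n in sequentially. \<forall>s\<in>K. dist (euler_ratio (x n s)) (euler_ratio (y s)) < e"
  proof eventually_elim
    case (elim n)
    show ?case
    proof
      fix s assume s: "s \<in> K"
      have "dist (euler_ratio (x n s)) (euler_ratio (y s)) \<le>
              dist (partial_ratio N (x n s)) (euler_ratio (x n s))
            + dist (partial_ratio N (x n s)) (partial_ratio N (y s))
            + dist (partial_ratio N (y s)) (euler_ratio (y s))"
        by (smt (verit) dist_commute dist_triangle)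
      moreover have "dist (partial_ratio N (x n s)) (partial_ratio N (y s)) < e / 3" using elim s by blast
      ultimately show "dist (euler_ratio (x n s)) (euler_ratio (y s)) < e"
        using N[OF x[OF s], of n] N[OF y[OF s]] by linarith
    qed
  qed
qed

section \<open>Kronecker approximation of phases at the primes\<close>

text \<open>Unique factorisation in additive form.  Moving the negative coefficients to the other side and exponentiating
  gives two equal products of prime powers; a prime with positive coefficient divides one of them and hence the other.
  The sign is treated first because the second half follows by replacing \<open>c\<close> with \<open>-c\<close>.\<close>
lemma ln_primes_relation_nonpos:
  fixes c :: "nat \<Rightarrow> int"
  assumes P: "finite P" "\<And>p. p \<in> P \<Longrightarrow> prime p"
    and rel: "(\<Sum>p\<in>P. of_int (c p) * ln (real p)) = 0" and q: "q \<in> P"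
  shows "c q \<le> 0"
proof (rule ccontr)
  assume "\<not> c q \<le> 0"
  define A where "A = {p\<in>P. c p > 0}"
  define B where "B = {p\<in>P. c p \<le> 0}"
  have fin: "finite A" "finite B" using P by (auto simp: A_def B_def)
  have pos: "real p > 0" if "p \<in> P" for p using P(2)[OF that] prime_gt_0_nat by simp
  have lnprod: "ln (real (\<Prod>p\<in>S. p ^ nat \<bar>c p\<bar>)) = (\<Sum>p\<in>S. of_int \<bar>c p\<bar> * ln (real p))"
    if "S \<subseteq> P" "finite S" for S
  proof -
    have "ln (real (\<Prod>p\<in>S. p ^ nat \<bar>c p\<bar>)) = (\<Sum>p\<in>S. ln (real p ^ nat \<bar>c p\<bar>))"
      using that pos by (subst of_nat_prod) (fastforce intro!: ln_prod)
    also have "\<dots> = (\<Sum>p\<in>S. of_int \<bar>c p\<bar> * ln (real p))"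
      using that pos by (intro sum.cong refl) (auto simp: ln_realpow)
    finally show ?thesis .
  qed
  have "(\<Sum>p\<in>P. of_int (c p) * ln (real p))
          = (\<Sum>p\<in>A. of_int (c p) * ln (real p)) + (\<Sum>p\<in>B. of_int (c p) * ln (real p))"
    by (subst sum.union_disjoint[symmetric])
       (use fin in \<open>auto simp: A_def B_def intro!: sum.cong\<close>)
  also have "(\<Sum>p\<in>A. of_int (c p) * ln (real p)) = (\<Sum>p\<in>A. of_int \<bar>c p\<bar> * ln (real p))"
    by (intro sum.cong) (auto simp: A_def)
  also have "(\<Sum>p\<in>B. of_int (c p) * ln (real p)) = - (\<Sum>p\<in>B. of_int \<bar>c p\<bar> * ln (real p))"
    unfolding sum_negf[symmetric] by (intro sum.cong) (auto simp: B_def)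
  finally have "ln (real (\<Prod>p\<in>A. p ^ nat \<bar>c p\<bar>)) = ln (real (\<Prod>p\<in>B. p ^ nat \<bar>c p\<bar>))"
    using rel lnprod[of A] lnprod[of B] fin by (simp add: A_def B_def del: of_nat_prod)
  moreover have "real (\<Prod>p\<in>S. p ^ nat \<bar>c p\<bar>) > 0" if "S \<subseteq> P" for S
    using that pos by (subst of_nat_prod) (intro prod_pos, auto)
  moreover have "A \<subseteq> P" "B \<subseteq> P" by (auto simp: A_def B_def)
  ultimately have "real (\<Prod>p\<in>A. p ^ nat \<bar>c p\<bar>) = real (\<Prod>p\<in>B. p ^ nat \<bar>c p\<bar>)"
    by (metis ln_inj_iff)
  then have eq: "(\<Prod>p\<in>A. p ^ nat \<bar>c p\<bar>) = (\<Prod>p\<in>B. p ^ nat \<bar>c p\<bar>)"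
    by (simp only: of_nat_eq_iff)
  have "q \<in> A" using q \<open>\<not> c q \<le> 0\<close> by (auto simp: A_def)
  then have "q dvd q ^ nat \<bar>c q\<bar>" by (auto simp: A_def intro!: dvd_power)
  also have "\<dots> dvd (\<Prod>p\<in>A. p ^ nat \<bar>c p\<bar>)"
    using \<open>q \<in> A\<close> fin by (intro dvd_prodI)
  finally have "q dvd (\<Prod>p\<in>B. p ^ nat \<bar>c p\<bar>)" unfolding eq .
  then obtain p where p: "p \<in> B" "q dvd p ^ nat \<bar>c p\<bar>"
    using P(2)[OF q] fin by (auto simp: prime_dvd_prod_iff)
  then have "q dvd p" using P(2)[OF q] prime_dvd_power by blast
  then have "q = p" using P(2) q p by (auto simp: B_def intro: primes_dvd_imp_eq)
  with p \<open>\<not> c q \<le> 0\<close> show False by (auto simp: B_def)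
qed

lemma ln_primes_independent:
  fixes c :: "nat \<Rightarrow> int"
  assumes P: "finite P" "\<And>p. p \<in> P \<Longrightarrow> prime p"
    and rel: "(\<Sum>p\<in>P. of_int (c p) * ln (real p)) = 0" and q: "q \<in> P"
  shows "c q = 0"
proof -
  have "(\<Sum>p\<in>P. of_int (- c p) * ln (real p)) = 0"
    using rel by (simp add: sum_negf)
  from ln_primes_relation_nonpos[OF P this q] ln_primes_relation_nonpos[OF P rel q]
  show ?thesis by simp
qed

lemma dist_cis_le: "norm (cis a - cis b) \<le> \<bar>a - b\<bar>"
proof -
  have "cis a - cis b = cis b * (exp (\<i> * of_real (a - b)) - 1)"
    by (simp add: cis_conv_exp exp_diff field_simps)
  also have "norm \<dots> = norm (exp (\<i> * of_real (a - b)) - 1)" by (simp add: norm_mult)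
  also have "\<dots> \<le> \<bar>a - b\<bar>"
    by (subst dist_exp_i_1) (use abs_sin_x_le_abs_x[of "(a - b) / 2"] in auto)
  finally show ?thesis .
qed

text \<open>Since the logarithms of the primes are independent over the integers, the phases \<open>p powr -(i t)\<close> for a suitable
  sequence of shifts \<open>t\<close> imitate any prescribed phases.  Kronecker's theorem handles the first \<open>n\<close> primes with
  error \<open>O(1 / n)\<close>, and letting \<open>n\<close> grow covers all primes.\<close>
lemma kronecker_primes:
  fixes \<omega> :: "nat \<Rightarrow> complex"
  assumes \<omega>: "\<And>p. prime p \<Longrightarrow> norm (\<omega> p) = 1"
  obtains t :: "nat \<Rightarrow> real"
  where "\<And>p. prime p \<Longrightarrow> (\<lambda>n. cis (- (t n * ln (real p)))) \<longlonglongrightarrow> \<omega> p"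
proof -
  define q where "q = enumerate {p::nat. prime p}"
  have inf: "infinite {p::nat. prime p}" by (rule primes_infinite)
  have q_prime: "prime (q i)" for i using enumerate_in_set[OF inf] by (auto simp: q_def)
  have q_mono: "strict_mono q" using strict_mono_enumerate[OF inf] by (simp add: q_def)
  have q_ge: "q i \<ge> i" for i using strict_mono_imp_increasing[OF q_mono] .
  define \<theta> where "\<theta> i = - ln (real (q i)) / (2 * pi)" for i
  define \<alpha> where "\<alpha> i = Arg (\<omega> (q i)) / (2 * pi)" for i
  have inj: "inj_on \<theta> I" for I
  proof (rule inj_onI)
    fix i j assume "\<theta> i = \<theta> j"
    then have "ln (real (q i)) = ln (real (q j))" by (simp add: \<theta>_def)
    then have "q i = q j" using q_prime by (simp add: prime_gt_0_nat)
    then show "i = j" using q_mono by (simp add: strict_mono_eq)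
  qed
  interpret Modules.module "(\<lambda>r. (*) (real_of_int r))"
    by (simp add: Modules.module.intro distrib_left mult.commute)
  \<comment> \<open>Angles are measured in full turns, which is the scale of Kronecker's theorem; the factor \<open>2 * pi\<close> does not affect independence\<close>
  have indep: "independent (\<theta> ` {..<n})" for n
    unfolding dependent_explicit
  proof safe
    fix T u v assume T: "finite T" "T \<subseteq> \<theta> ` {..<n}" and sum0: "(\<Sum>v\<in>T. real_of_int (u v) * v) = 0"
      and v: "v \<in> T" "u v \<noteq> 0"
    obtain I where I: "I \<subseteq> {..<n}" "T = \<theta> ` I" using T by (auto simp: subset_image_iff)
    then have "finite I" using finite_subset by blast
    have "(\<Sum>i\<in>I. real_of_int (u (\<theta> i)) * \<theta> i) = 0"
      using sum0 inj by (simp add: I sum.reindex)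
    then have "(\<Sum>i\<in>I. real_of_int (u (\<theta> i)) * ln (real (q i))) / (2 * pi) = 0"
      by (simp add: \<theta>_def sum_divide_distrib sum_negf)
    then have "(\<Sum>i\<in>I. real_of_int (u (\<theta> i)) * ln (real (q i))) = 0" by simp
    then have "(\<Sum>p\<in>q ` I. real_of_int (u (- ln (real p) / (2 * pi))) * ln (real p)) = 0"
      using strict_mono_imp_inj_on[OF q_mono] by (subst sum.reindex) (auto simp: \<theta>_def inj_on_def)
    from ln_primes_independent[OF _ _ this] \<open>finite I\<close> q_prime
    have "u (\<theta> i) = 0" if "i \<in> I" for i using that by (auto simp: \<theta>_def)
    with v I show False by auto
  qed
  have "\<exists>t. \<forall>i<n. norm (cis (- (t * ln (real (q i)))) - \<omega> (q i)) < 2 * pi / Suc n" for n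
  proof -
    obtain t h where th: "\<And>i. i < n \<Longrightarrow> \<bar>t * \<theta> i - of_int (h i) - \<alpha> i\<bar> < 1 / Suc n"
      using Kronecker_thm_1[OF indep inj, where \<epsilon> = "1 / real (Suc n)" and n = n and \<alpha> = \<alpha>] by auto
    have "norm (cis (- (t * ln (real (q i)))) - \<omega> (q i)) < 2 * pi / Suc n" if "i < n" for i
    proof -
      have "\<omega> (q i) = cis (2 * pi * \<alpha> i)"
        using \<omega>[OF q_prime, of i] rcis_cmod_Arg[of "\<omega> (q i)"] by (simp add: \<alpha>_def rcis_def)
      also have "\<dots> = cis (2 * pi * (\<alpha> i + of_int (h i)))"
        by (simp add: distrib_left cis_mult[symmetric] cis_multiple_2pi)
      finally have "norm (cis (- (t * ln (real (q i)))) - \<omega> (q i))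
          \<le> \<bar>- (t * ln (real (q i))) - 2 * pi * (\<alpha> i + of_int (h i))\<bar>"
        by (simp add: dist_cis_le)
      also have "\<dots> = 2 * pi * \<bar>t * \<theta> i - of_int (h i) - \<alpha> i\<bar>"
        by (simp add: \<theta>_def abs_mult[symmetric] field_simps del: abs_mult)
      also have "\<dots> < 2 * pi * (1 / Suc n)"
        by (intro mult_strict_left_mono th that) auto
      finally show ?thesis by simp
    qed
    then show ?thesis by blast
  qed
  then obtain t where t: "\<And>n i. i < n \<Longrightarrow> norm (cis (- (t n * ln (real (q i)))) - \<omega> (q i)) < 2 * pi / Suc n"
    by metis
  show ?thesis
  proof (rule that)
    fix p :: nat assume "prime p"
    then obtain i where i: "q i = p" using enumerate_Ex[OF inf, of p] by (auto simp: q_def)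
    have "(\<lambda>n. cis (- (t n * ln (real p))) - \<omega> p) \<longlonglongrightarrow> 0"
    proof (rule Lim_null_comparison)
      show "\<forall>\<^sub>F n in sequentially. norm (cis (- (t n * ln (real p))) - \<omega> p) \<le> 2 * pi / Suc n"
        using eventually_gt_at_top[of i] by eventually_elim (use t i in \<open>auto intro!: less_imp_le\<close>)
      show "(\<lambda>n. 2 * pi / Suc n) \<longlonglongrightarrow> 0"
        by (rule LIMSEQ_Suc[OF lim_const_over_n])
    qed
    then show "(\<lambda>n. cis (- (t n * ln (real p)))) \<longlonglongrightarrow> \<omega> p" by (simp add: LIM_zero_iff)
  qed
qed

section \<open>The argument of a local factor\<close>

text \<open>Angular sectors record an argument without a branch: half-angles simply add under multiplication, however large
  they become.  Allowing \<open>\<rho> = 0\<close> is harmless and saves a side condition.\<close>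
definition sector :: "real \<Rightarrow> complex set" where
  "sector \<alpha> = {rcis \<rho> \<theta> | \<rho> \<theta>. \<rho> \<ge> 0 \<and> \<bar>\<theta>\<bar> \<le> \<alpha>}"

lemma sector_mult: "z \<in> sector \<alpha> \<Longrightarrow> w \<in> sector \<beta> \<Longrightarrow> z * w \<in> sector (\<alpha> + \<beta>)"
  unfolding sector_def
  by (clarsimp simp: rcis_mult) (metis abs_triangle_ineq add_mono mult_nonneg_nonneg order_trans)

lemma sector_prod:
  assumes "\<And>i. i \<in> I \<Longrightarrow> f i \<in> sector (\<alpha> i)"
  shows "(\<Prod>i\<in>I. f i) \<in> sector (\<Sum>i\<in>I. \<alpha> i)"
  using assms
proof (induction I rule: infinite_finite_induct)
  case (insert i I)
  then show ?case by (simp add: sector_mult)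
qed (auto simp: sector_def intro!: exI[of _ 1] exI[of _ "0::real"])

lemma sector_mono: "\<alpha> \<le> \<beta> \<Longrightarrow> sector \<alpha> \<subseteq> sector \<beta>"
  unfolding sector_def by force

lemma mem_sector_arctan:
  assumes "Re z > 0" "\<bar>Im z\<bar> \<le> t * Re z"
  shows "z \<in> sector (arctan t)"
proof -
  define y where "y = Im z / Re z"
  have y: "\<bar>y\<bar> \<le> t" using assms by (simp add: y_def abs_divide field_simps)
  have "z = rcis (Re z * sqrt (1 + y\<^sup>2)) (arctan y)"
    using assms by (auto simp: complex_eq_iff cos_arctan sin_arctan y_def add_nonneg_eq_0_iff)
  moreover have "\<bar>arctan y\<bar> \<le> arctan t"
    using y by (metis abs_le_iff arctan_le_iff arctan_minus)
  ultimately show ?thesis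
    unfolding sector_def using assms
    by (intro CollectI exI[of _ "Re z * sqrt (1 + y\<^sup>2)"] exI[of _ "arctan y"]) auto
qed

text \<open>The sector as a closed condition, which survives passage to the limit of the partial products.\<close>
lemma sector_Re_ge:
  assumes "z \<in> sector \<alpha>" "\<alpha> \<le> pi"
  shows "Re z \<ge> cos \<alpha> * norm z"
proof -
  from assms obtain \<rho> \<theta> where z: "z = rcis \<rho> \<theta>" "\<rho> \<ge> 0" "\<bar>\<theta>\<bar> \<le> \<alpha>"
    by (auto simp: sector_def)
  have "cos \<alpha> \<le> cos \<bar>\<theta>\<bar>"
    using z assms by (intro cos_monotone_0_pi_le) auto
  then have "\<rho> * cos \<alpha> \<le> \<rho> * cos \<theta>" using z by (intro mult_left_mono) auto
  with z show ?thesis by (simp add: mult.commute)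
qed

text \<open>Taking \<open>k\<close>-th powers multiplies the argument by \<open>k\<close>, so it takes an argument of at least \<open>pi / k\<close> to reach \<open>-1\<close>.\<close>
lemma power_neq_minus_one:
  assumes z: "Re z \<ge> cos \<alpha> * norm z" and \<alpha>: "0 \<le> \<alpha>" "real k * \<alpha> < pi" "\<alpha> \<le> pi"
  shows "z ^ k \<noteq> -1"
proof
  assume eq: "z ^ k = -1"
  then have "z \<noteq> 0" by (auto simp: power_0_left split: if_splits)
  have arg: "\<bar>Arg z\<bar> \<le> \<alpha>"
  proof (rule ccontr)
    assume "\<not> ?thesis"
    moreover have "\<bar>Arg z\<bar> \<le> pi" using Arg_bounded[of z] by auto
    ultimately have "cos \<bar>Arg z\<bar> < cos \<alpha>" using \<alpha> by (intro cos_monotone_0_pi) auto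
    then have "norm z * cos (Arg z) < norm z * cos \<alpha>" using \<open>z \<noteq> 0\<close> by simp
    moreover have "Re z = norm z * cos (Arg z)"
      using rcis_cmod_Arg[of z] by (metis Re_rcis)
    ultimately show False using z by (simp add: mult.commute)
  qed
  have "norm z ^ k = 1" using arg_cong[OF eq, of norm] by (simp add: norm_power)
  have "z ^ k = rcis (norm z ^ k) (real k * Arg z)"
    by (metis DeMoivre2 rcis_cmod_Arg)
  also have "\<dots> = cis (real k * Arg z)" using \<open>norm z ^ k = 1\<close> by (simp add: rcis_def)
  finally have "cos (real k * Arg z) = -1" using eq by (simp add: complex_eq_iff)
  moreover have "cos pi < cos \<bar>real k * Arg z\<bar>"
  proof (rule cos_monotone_0_pi)
    have "\<bar>real k * Arg z\<bar> \<le> real k * \<alpha>" using arg by (simp add: abs_mult mult_left_mono)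
    with \<alpha> show "\<bar>real k * Arg z\<bar> < pi" by simp
  qed auto
  ultimately show False by simp
qed

lemma local_factor_Re_Im:
  assumes "norm x < 1"
  shows "Re (local_factor x) = (1 + 2 * Re x + 2 * (Re x)\<^sup>2 + (norm x)\<^sup>2 * Re x) / (norm (1 + x))\<^sup>2"
    and "Im (local_factor x) = Im x * (2 * Re x + (norm x)\<^sup>2) / (norm (1 + x))\<^sup>2"
proof -
  have nz: "1 + x \<noteq> 0" using assms by (rule one_plus_nonzero)
  define D where "D = (norm (1 + x))\<^sup>2"
  have "D \<noteq> 0" using nz by (simp add: D_def)
  have "local_factor x = (1 + x + x\<^sup>2) / (1 + x)"
    using nz by (simp add: local_factor_def add_divide_distrib[of "1 + x"])
  also have "\<dots> = (1 + x + x\<^sup>2) * cnj (1 + x) / of_real D"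
    by (simp only: complex_div_cnj[of _ "1 + x"] D_def)
  finally have eq: "local_factor x = (1 + x + x\<^sup>2) * cnj (1 + x) / of_real D" .
  show "Re (local_factor x) = (1 + 2 * Re x + 2 * (Re x)\<^sup>2 + (norm x)\<^sup>2 * Re x) / (norm (1 + x))\<^sup>2"
    unfolding eq D_def[symmetric] Re_divide_of_real cmod_power2[of x]
    by (rule arg_cong[of _ _ "\<lambda>u. u / D"]) (simp add: power2_eq_square algebra_simps)
  show "Im (local_factor x) = Im x * (2 * Re x + (norm x)\<^sup>2) / (norm (1 + x))\<^sup>2"
    unfolding eq D_def[symmetric] Im_divide_of_real cmod_power2[of x]
    by (rule arg_cong[of _ _ "\<lambda>u. u / D"]) (simp add: power2_eq_square algebra_simps)
qed

text \<open>Being in a sector means that two real linear forms in the value are nonpositive.  These are real parts of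
  holomorphic functions of \<open>x\<close>, so by the maximum principle only the circle \<open>|x| = r\<close> matters, and there
  the condition is a polynomial inequality in the single variable \<open>a = Re x\<close>.\<close>
lemma local_factor_sector_from_circle:
  assumes r: "0 < r" "r < 1" and t: "0 \<le> t"
    and circle: "\<And>a. \<bar>a\<bar> \<le> r \<Longrightarrow>
      (r\<^sup>2 - a\<^sup>2) * (2 * a + r\<^sup>2)\<^sup>2 \<le> t\<^sup>2 * (1 + 2 * a + 2 * a\<^sup>2 + r\<^sup>2 * a)\<^sup>2"
    and pos: "\<And>a. \<bar>a\<bar> \<le> r \<Longrightarrow> 0 \<le> 1 + 2 * a + 2 * a\<^sup>2 + r\<^sup>2 * a"
    and x: "norm x \<le> r"
  shows "\<bar>Im (local_factor x)\<bar> \<le> t * Re (local_factor x)"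
proof -
  have edge: "\<bar>Im (local_factor z)\<bar> \<le> t * Re (local_factor z)" if z: "norm z = r" for z
  proof -
    have a: "\<bar>Re z\<bar> \<le> r" using abs_Re_le_cmod[of z] z by simp
    have b: "(Im z)\<^sup>2 = r\<^sup>2 - (Re z)\<^sup>2" using cmod_power2[of z] z by simp
    have "(Im z * (2 * Re z + r\<^sup>2))\<^sup>2 \<le> (t * (1 + 2 * Re z + 2 * (Re z)\<^sup>2 + r\<^sup>2 * Re z))\<^sup>2"
      using circle[OF a] by (simp add: power_mult_distrib b)
    then have "\<bar>Im z * (2 * Re z + r\<^sup>2)\<bar> \<le> t * (1 + 2 * Re z + 2 * (Re z)\<^sup>2 + r\<^sup>2 * Re z)"
      using t pos[OF a] by (simp only: abs_le_square_iff[symmetric]) (simp add: abs_mult)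
    then show ?thesis
      using z r by (simp add: local_factor_Re_Im divide_right_mono)
  qed
  have key: "Re ((c * local_factor x)) \<le> 0" if c: "c = Complex (- t) (-1) \<or> c = Complex (- t) 1" for c
  proof (rule maximum_real_frontier[of "\<lambda>z. c * local_factor z" "cball 0 r"])
    show "(\<lambda>z. c * local_factor z) holomorphic_on interior (cball 0 r)"
      using r by (intro holomorphic_intros holomorphic_on_subset[OF holomorphic_on_local_factor]) auto
    show "continuous_on (closure (cball 0 r)) (\<lambda>z. c * local_factor z)"
      using r by (intro continuous_intros continuous_on_subset[OF continuous_on_local_factor]) auto
    show "bounded (cball 0 r :: complex set)" by simp
    show "x \<in> cball 0 r" using x by simp
    fix z assume "z \<in> frontier (cball (0::complex) r)"
    then have "norm z = r" using r by (simp add: frontier_cball)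
    from edge[OF this] c show "Re (c * local_factor z) \<le> 0" by auto
  qed
  from key[of "Complex (- t) (-1)"] key[of "Complex (- t) 1"] show ?thesis by auto
qed


text \<open>The largest tangents for the primes \<open>2, 3, 5, 7\<close> are about \<open>0.39431, 0.14579, 0.04664, 0.02272\<close>; since the sum of all
  maximal arguments is only about one percent below \<open>pi / 5\<close>, the rational bounds have to be nearly sharp.  In each
  case the quartic in \<open>a\<close> is written as a positive combination of two squares and a tiny positive constant: the first square
  is fixed up to its constant term by the two leading coefficients, that term is chosen close to the double root which the quartic almost has,
  and the second square completes the remaining quadratic.\<close>
lemma local_factor_tan_bound_two:
  assumes "norm x \<le> 1 / 2"
  shows "\<bar>Im (local_factor x)\<bar> \<le> 15 / 38 * Re (local_factor x)"
proof (rule local_factor_sector_from_circle[of "1 / 2"])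
  fix a :: real
  have "(15 / 38)\<^sup>2 * (1 + 2 * a + 2 * a\<^sup>2 + (1 / 2)\<^sup>2 * a)\<^sup>2 - ((1 / 2)\<^sup>2 - a\<^sup>2) * (2 * a + (1 / 2)\<^sup>2)\<^sup>2
      = 1669 / 361 * (a\<^sup>2 + 3469 / 13352 * a + (-3 / 50))\<^sup>2 + 10804583 / 15062725 * (a + (35868479 / 86436664))\<^sup>2 + 1140099003 / 39004544630000"
    by (simp add: power2_eq_square field_simps)
  also have "\<dots> \<ge> 0" by simp
  finally show "((1 / 2)\<^sup>2 - a\<^sup>2) * (2 * a + (1 / 2)\<^sup>2)\<^sup>2
      \<le> (15 / 38)\<^sup>2 * (1 + 2 * a + 2 * a\<^sup>2 + (1 / 2)\<^sup>2 * a)\<^sup>2" by simp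
  have "1 + 2 * a + 2 * a\<^sup>2 + (1 / 2)\<^sup>2 * a = 2 * (a + 9 / 16)\<^sup>2 + 47 / 128"
    by (simp add: power2_eq_square field_simps)
  also have "\<dots> \<ge> 0" by simp
  finally show "0 \<le> 1 + 2 * a + 2 * a\<^sup>2 + (1 / 2)\<^sup>2 * a" .
qed (use assms in auto)

lemma local_factor_tan_bound_three:
  assumes "norm x \<le> 1 / 3"
  shows "\<bar>Im (local_factor x)\<bar> \<le> 7 / 48 * Re (local_factor x)"
proof (rule local_factor_sector_from_circle[of "1 / 3"])
  fix a :: real
  have "(7 / 48)\<^sup>2 * (1 + 2 * a + 2 * a\<^sup>2 + (1 / 3)\<^sup>2 * a)\<^sup>2 - ((1 / 3)\<^sup>2 - a\<^sup>2) * (2 * a + (1 / 3)\<^sup>2)\<^sup>2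
      = 2353 / 576 * (a\<^sup>2 + 3235 / 42354 * a + (-1 / 20))\<^sup>2 + 1794859 / 13553280 * (a + (176475 / 652676))\<^sup>2 + 6851591 / 6090250291200"
    by (simp add: power2_eq_square field_simps)
  also have "\<dots> \<ge> 0" by simp
  finally show "((1 / 3)\<^sup>2 - a\<^sup>2) * (2 * a + (1 / 3)\<^sup>2)\<^sup>2
      \<le> (7 / 48)\<^sup>2 * (1 + 2 * a + 2 * a\<^sup>2 + (1 / 3)\<^sup>2 * a)\<^sup>2" by simp
  have "1 + 2 * a + 2 * a\<^sup>2 + (1 / 3)\<^sup>2 * a = 2 * (a + 19 / 36)\<^sup>2 + 287 / 648"
    by (simp add: power2_eq_square field_simps)
  also have "\<dots> \<ge> 0" by simp
  finally show "0 \<le> 1 + 2 * a + 2 * a\<^sup>2 + (1 / 3)\<^sup>2 * a" .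
qed (use assms in auto)

lemma local_factor_tan_bound_five:
  assumes "norm x \<le> 1 / 5"
  shows "\<bar>Im (local_factor x)\<bar> \<le> 7 / 150 * Re (local_factor x)"
proof (rule local_factor_sector_from_circle[of "1 / 5"])
  fix a :: real
  have "(7 / 150)\<^sup>2 * (1 + 2 * a + 2 * a\<^sup>2 + (1 / 5)\<^sup>2 * a)\<^sup>2 - ((1 / 5)\<^sup>2 - a\<^sup>2) * (2 * a + (1 / 5)\<^sup>2)\<^sup>2
      = 22549 / 5625 * (a\<^sup>2 + 24999 / 1127450 * a + (-81 / 4000))\<^sup>2 + 5011651481 / 253676250000 * (a + (77183400531 / 501165148100))\<^sup>2 + 3094218194031499 / 2255243166450000000000"
    by (simp add: power2_eq_square field_simps)
  also have "\<dots> \<ge> 0" by simp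
  finally show "((1 / 5)\<^sup>2 - a\<^sup>2) * (2 * a + (1 / 5)\<^sup>2)\<^sup>2
      \<le> (7 / 150)\<^sup>2 * (1 + 2 * a + 2 * a\<^sup>2 + (1 / 5)\<^sup>2 * a)\<^sup>2" by simp
  have "1 + 2 * a + 2 * a\<^sup>2 + (1 / 5)\<^sup>2 * a = 2 * (a + 51 / 100)\<^sup>2 + 2399 / 5000"
    by (simp add: power2_eq_square field_simps)
  also have "\<dots> \<ge> 0" by simp
  finally show "0 \<le> 1 + 2 * a + 2 * a\<^sup>2 + (1 / 5)\<^sup>2 * a" .
qed (use assms in auto)

lemma local_factor_tan_bound_seven:
  assumes "norm x \<le> 1 / 7"
  shows "\<bar>Im (local_factor x)\<bar> \<le> 1 / 44 * Re (local_factor x)"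
proof (rule local_factor_sector_from_circle[of "1 / 7"])
  fix a :: real
  have "(1 / 44)\<^sup>2 * (1 + 2 * a + 2 * a\<^sup>2 + (1 / 7)\<^sup>2 * a)\<^sup>2 - ((1 / 7)\<^sup>2 - a\<^sup>2) * (2 * a + (1 / 7)\<^sup>2)\<^sup>2
      = 1937 / 484 * (a\<^sup>2 + 2035 / 189826 * a + (-13 / 1250))\<^sup>2 + 7492949 / 1305053750 * (a + (168005695 / 1468618004))\<^sup>2 + 70376455071 / 2473703450487500000"
    by (simp add: power2_eq_square field_simps)
  also have "\<dots> \<ge> 0" by simp
  finally show "((1 / 7)\<^sup>2 - a\<^sup>2) * (2 * a + (1 / 7)\<^sup>2)\<^sup>2
      \<le> (1 / 44)\<^sup>2 * (1 + 2 * a + 2 * a\<^sup>2 + (1 / 7)\<^sup>2 * a)\<^sup>2" by simp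
  have "1 + 2 * a + 2 * a\<^sup>2 + (1 / 7)\<^sup>2 * a = 2 * (a + 99 / 196)\<^sup>2 + 9407 / 19208"
    by (simp add: power2_eq_square field_simps)
  also have "\<dots> \<ge> 0" by simp
  finally show "0 \<le> 1 + 2 * a + 2 * a\<^sup>2 + (1 / 7)\<^sup>2 * a" .
qed (use assms in auto)

section \<open>The total argument is below one fifth of pi\<close>

lemma cos_ge: "1 - y\<^sup>2 / 2 \<le> cos y" for y :: real
proof -
  have "(sin (y / 2))\<^sup>2 \<le> (y / 2)\<^sup>2"
    using abs_sin_x_le_abs_x[of "y / 2"] by (simp only: abs_le_square_iff)
  then show ?thesis using cos_double_sin[of "y / 2"] by (simp add: power_divide)
qed


lemma sin_ge: "0 \<le> y \<Longrightarrow> y - y ^ 3 / 6 \<le> sin y" for y :: real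
proof -
  assume "0 \<le> y"
  have "\<bar>sin y - y\<bar> \<le> \<bar>y\<bar> ^ 3 / 6"
    using Maclaurin_sin_bound[of y 3] by (simp add: numeral_eq_Suc sin_coeff_def fact_numeral field_simps)
  moreover have "\<bar>y\<bar> ^ 3 = y ^ 3" using \<open>0 \<le> y\<close> by simp
  ultimately show ?thesis by linarith
qed

text \<open>Upper bounds for the argument of a local factor.  For large \<open>p\<close> the disc of radius \<open>w = 1 / (p^2 - p)\<close> around \<open>1\<close>
  suffices, and \<open>w / (1 - w) = 1 / (p^2 - p - 1)\<close> bounds the tangent there.\<close>
definition arg_bound :: "nat \<Rightarrow> real" where
  "arg_bound p = (if p = 2 then arctan (15 / 38) else if p = 3 then arctan (7 / 48)
     else if p = 5 then arctan (7 / 150) else if p = 7 then arctan (1 / 44)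
     else 1 / (real p ^ 2 - real p - 1))"

lemma square_minus_self_minus_one_pos:
  assumes "p \<ge> (2::nat)"
  shows "real p ^ 2 - real p - 1 > 0"
proof -
  have "real p \<ge> 2" using assms by simp
  then have "real p * real p \<ge> 2 * real p" by (intro mult_right_mono) auto
  then show ?thesis using \<open>real p \<ge> 2\<close> unfolding power2_eq_square by linarith
qed

lemma local_factor_in_sector:
  assumes p: "prime p" and x: "norm x \<le> 1 / real p"
  shows "local_factor x \<in> sector (arg_bound p)"
proof -
  have p2: "p \<ge> 2" using p by (rule prime_ge_2_nat)
  define w where "w = norm (local_factor x - 1)"
  have Re_ge: "Re (local_factor x) \<ge> 1 - w"
    using abs_Re_le_cmod[of "local_factor x - 1"] by (simp add: w_def)
  have Im_le: "\<bar>Im (local_factor x)\<bar> \<le> w"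
    using abs_Im_le_cmod[of "local_factor x - 1"] by (simp add: w_def)
  have "w \<le> 2 / real p ^ 2"
    unfolding w_def using x p2 by (rule local_factor_admissible)
  also have "\<dots> \<le> 2 / 2 ^ 2" using p2 by (intro divide_left_mono power_mono) auto
  finally have Re_pos: "Re (local_factor x) > 0" using Re_ge by simp
  consider "p = 2" | "p = 3" | "p = 5" | "p = 7" | "p \<ge> 8" | "p = 4" | "p = 6"
    using p2 by linarith
  then show ?thesis
  proof cases
    case 5
    define q where "q = real p ^ 2 - real p - 1"
    have q: "q > 0" unfolding q_def using 5 by (intro square_minus_self_minus_one_pos) simp
    have "w \<le> (1 / real p)\<^sup>2 / (1 - 1 / real p)"
      unfolding w_def using x 5 by (intro norm_local_factor_minus_1) auto
    also have "\<dots> = 1 / (q + 1)"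
      using 5 by (simp add: q_def field_simps power2_eq_square)
    finally have w: "w \<le> 1 / (q + 1)" .
    then have "w \<le> 1 / q * (1 - w)"
      using q by (simp add: field_simps)
    also have "\<dots> \<le> 1 / q * Re (local_factor x)"
      using Re_ge q by (intro mult_left_mono) auto
    finally have "local_factor x \<in> sector (arctan (1 / q))"
      using Im_le Re_pos by (intro mem_sector_arctan) auto
    moreover have "arctan (1 / q) \<le> 1 / q" using q by (intro arctan_le_self) auto
    ultimately show ?thesis
      using sector_mono 5 by (auto simp: arg_bound_def q_def)
  qed (use x p Re_pos in \<open>auto simp: arg_bound_def intro!: mem_sector_arctan
         local_factor_tan_bound_two local_factor_tan_bound_three
         local_factor_tan_bound_five local_factor_tan_bound_seven\<close>)
qed

lemma arg_bound_nonneg: "p \<ge> 2 \<Longrightarrow> arg_bound p \<ge> 0"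
  using square_minus_self_minus_one_pos[of p] by (simp add: arg_bound_def)

text \<open>Primes beyond \<open>3\<close> have the form \<open>6j - 1\<close> or \<open>6j + 1\<close>, and each such pair is dominated by a telescoping difference.
  Asymptotically the constant could be \<open>1/3\<close>; \<open>0.343\<close> is what \<open>j = 5\<close> needs.\<close>
lemma sum_arg_bound_tail:
  assumes "j \<ge> 5"
  shows "(\<Sum>p | prime p \<and> 27 \<le> p \<and> p < 6 * j - 3. arg_bound p) \<le> 343 / 1000 * (1 / 27 - 1 / (6 * real j - 3))"
  using assms
proof (induction j rule: dec_induct)
  case base
  have "{p::nat. prime p \<and> 27 \<le> p \<and> p < 6 * 5 - 3} = {}" by auto
  then show ?case by (simp only: sum.empty) simp
next
  case (step j)
  \<comment> \<open>In terms of \<open>m\<close> all polynomial inequalities below have nonnegative coefficients\<close>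
  define m where "m = real j - 5"
  have m: "m \<ge> 0" "real j = m + 5" using step by (auto simp: m_def)
  let ?S = "{p. prime p \<and> 27 \<le> p \<and> p < 6 * j - 3}"
  have sub: "{p. prime p \<and> 27 \<le> p \<and> p < 6 * Suc j - 3} \<subseteq> ?S \<union> {6 * j - 1, 6 * j + 1}"
  proof
    fix p assume "p \<in> {p. prime p \<and> 27 \<le> p \<and> p < 6 * Suc j - 3}"
    then have p: "prime p" "27 \<le> p" "p < 6 * j + 3" by auto
    show "p \<in> ?S \<union> {6 * j - 1, 6 * j + 1}"
    proof (cases "p < 6 * j - 3")
      case False
      have "\<not> 2 dvd p" "\<not> 3 dvd p"
        using p primes_dvd_imp_eq[of 2 p] primes_dvd_imp_eq[of 3 p] by auto
      moreover have "p \<in> {6 * j - 3, 6 * j - 2, 6 * j - 1, 6 * j, 6 * j + 1, 6 * j + 2}"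
        using False p by auto
      ultimately show ?thesis using step by auto
    qed (use p in auto)
  qed
  have g: "arg_bound (6 * j - 1) = 1 / (36 * real j ^ 2 - 18 * real j + 1)"
          "arg_bound (6 * j + 1) = 1 / (36 * real j ^ 2 + 6 * real j - 1)"
    using step by (auto simp: arg_bound_def of_nat_diff power2_eq_square algebra_simps)
  have "(\<Sum>p | prime p \<and> 27 \<le> p \<and> p < 6 * Suc j - 3. arg_bound p)
        \<le> (\<Sum>p\<in>?S \<union> {6 * j - 1, 6 * j + 1}. arg_bound p)"
  proof (rule sum_mono2[OF _ sub])
    fix p assume "p \<in> ?S \<union> {6 * j - 1, 6 * j + 1} - {p. prime p \<and> 27 \<le> p \<and> p < 6 * Suc j - 3}"
    then have "p \<ge> 2" using step by auto
    then show "0 \<le> arg_bound p" by (rule arg_bound_nonneg)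
  qed auto
  also have "\<dots> = (\<Sum>p\<in>?S. arg_bound p) + (arg_bound (6 * j - 1) + arg_bound (6 * j + 1))"
    using step by (subst sum.union_disjoint) auto
  also have "arg_bound (6 * j - 1) + arg_bound (6 * j + 1)
      \<le> 343 / 1000 * (1 / (6 * real j - 3) - 1 / (6 * real (Suc j) - 3))"
  proof -
    have pos: "36 * (m + 5) ^ 2 - 18 * (m + 5) + 1 > 0" "36 * (m + 5) ^ 2 + 6 * (m + 5) - 1 > 0"
              "6 * (m + 5) - 3 > 0" "6 * (m + 6) - 3 > 0"
      using m by (auto simp: power2_eq_square algebra_simps intro!: add_nonneg_pos[of "m * (m * 36)"])
    have "1 / (36 * (m + 5) ^ 2 - 18 * (m + 5) + 1) + 1 / (36 * (m + 5) ^ 2 + 6 * (m + 5) - 1)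
        = (72 * (m + 5) ^ 2 - 12 * (m + 5)) / ((36 * (m + 5) ^ 2 - 18 * (m + 5) + 1) * (36 * (m + 5) ^ 2 + 6 * (m + 5) - 1))"
      using pos by (simp add: add_frac_eq)
    also have "\<dots> \<le> (343 / 1000 * 6) / ((6 * (m + 5) - 3) * (6 * (m + 6) - 3))"
    proof -
      have "(72 * (m + 5) ^ 2 - 12 * (m + 5)) * ((6 * (m + 5) - 3) * (6 * (m + 6) - 3))
        \<le> (343 / 1000 * 6) * ((36 * (m + 5) ^ 2 - 18 * (m + 5) + 1) * (36 * (m + 5) ^ 2 + 6 * (m + 5) - 1))"
        (is "?L \<le> ?R")
      proof -
        have "?R - ?L \<ge> 0"
          using m zero_le_power[OF m(1)] by (simp add: power2_eq_square algebra_simps)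
        then show ?thesis by simp
      qed
      then show ?thesis using mult_pos_pos[OF pos(1,2)] mult_pos_pos[OF pos(3,4)]
        by (simp only: pos_divide_le_eq times_divide_eq_left pos_le_divide_eq)
    qed
    also have "\<dots> = 343 / 1000 * (1 / (6 * (m + 5) - 3) - 1 / (6 * (m + 6) - 3))"
      using pos by (simp add: diff_frac_eq algebra_simps)
    finally show ?thesis unfolding g m(2) by (simp add: m(2))
  qed
  finally show ?case using step.IH unfolding right_diff_distrib by linarith
qed

text \<open>The last term exceeds the sum over \<open>11, 13, 17, 19, 23\<close> plus the bound \<open>343 / 27000\<close> for all primes from \<open>29\<close> on.  Starting the
  telescoping later than \<open>25\<close> matters: counting that composite number would cost more than the available slack.\<close>
definition total_arg_bound :: real where
  "total_arg_bound = arctan (15 / 38) + arctan (7 / 48) + arctan (7 / 150) + arctan (1 / 44) + 3694 / 100000"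

lemma sum_arg_bound_le: "(\<Sum>p\<in>primes_below N. arg_bound p) \<le> total_arg_bound"
proof -
  let ?T = "{p. prime p \<and> 27 \<le> p \<and> p < 6 * (N + 5) - 3}"
  let ?S = "{2, 3, 5, 7, 11, 13, 17, 19, 23} :: nat set"
  have small: "p \<in> ?S" if "prime p" "p < 27" for p :: nat
  proof (rule ccontr)
    assume "p \<notin> ?S"
    have "\<not> 2 dvd p \<or> p = 2" "\<not> 3 dvd p \<or> p = 3" "\<not> 5 dvd p \<or> p = 5"
      using that primes_dvd_imp_eq[of 2 p] primes_dvd_imp_eq[of 3 p] primes_dvd_imp_eq[of 5 p] by auto
    moreover have "p \<ge> 2" using that by (intro prime_ge_2_nat)
    then have "p = 2 \<or> p = 3 \<or> p = 4 \<or> p = 5 \<or> p = 6 \<or> p = 7 \<or> p = 8 \<or> p = 9 \<or> p = 10 \<or> p = 11 \<or> p = 12 \<or> p = 13 \<or> p = 14 \<or> p = 15 \<or> p = 16 \<or> p = 17 \<or> p = 18 \<or> p = 19 \<or> p = 20 \<or> p = 21 \<or> p = 22 \<or> p = 23 \<or> p = 24 \<or> p = 25 \<or> p = 26"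
      using that(2) by presburger
    ultimately show False using \<open>p \<notin> ?S\<close> by (elim disjE) simp_all
  qed
  have sub: "primes_below N \<subseteq> ?S \<union> ?T"
  proof
    fix p assume "p \<in> primes_below N"
    then show "p \<in> ?S \<union> ?T"
      using small[of p] by (cases "p < 27") (auto simp: primes_below_def)
  qed
  have "(\<Sum>p\<in>primes_below N. arg_bound p) \<le> (\<Sum>p\<in>?S \<union> ?T. arg_bound p)"
    by (rule sum_mono2[OF _ sub]) (auto intro!: arg_bound_nonneg prime_ge_2_nat)
  also have "\<dots> = (\<Sum>p\<in>?S. arg_bound p) + (\<Sum>p\<in>?T. arg_bound p)"
    by (rule sum.union_disjoint) auto
  also have "(\<Sum>p\<in>?T. arg_bound p) \<le> 343 / 1000 * (1 / 27 - 1 / (6 * real (N + 5) - 3))"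
    by (rule sum_arg_bound_tail) simp
  also have "\<dots> \<le> 343 / 27000" by simp
  also have "(\<Sum>p\<in>?S. arg_bound p) + 343 / 27000 \<le> total_arg_bound"
    by (simp add: arg_bound_def total_arg_bound_def)
  finally show ?thesis by simp
qed

text \<open>The margin is about \<open>0.006\<close>.  The addition theorem collects everything below
  \<open>arctan (29 / 40)\<close>, and doubling twice compares five times this angle with \<open>pi\<close> exactly.\<close>
lemma total_arg_bound_less: "5 * total_arg_bound < pi"
proof -
  define \<tau> :: real where "\<tau> = 3694 / 100000"
  have \<tau>: "0 < \<tau>" "\<tau> < pi / 2" using pi_gt3 by (auto simp: \<tau>_def)
  have cos: "1 - \<tau>\<^sup>2 / 2 \<le> cos \<tau>" by (rule cos_ge)
  have "tan \<tau> \<le> \<tau> / (1 - \<tau>\<^sup>2 / 2)"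
    unfolding tan_def using cos \<tau> by (intro frac_le sin_x_le_x) (auto simp: \<tau>_def power2_eq_square)
  also have "\<dots> \<le> 37 / 1000" by (simp add: \<tau>_def power2_eq_square)
  finally have "arctan (tan \<tau>) \<le> arctan (37 / 1000)" by (simp only: arctan_le_iff)
  then have \<tau>_le: "\<tau> \<le> arctan (37 / 1000)" using \<tau> by (simp add: arctan_tan)
  have s1: "arctan (15 / 38) + arctan (7 / 48) = arctan (986 / 1719)"
    by (subst arctan_add) (simp_all)
  have s2: "arctan (7 / 150) + arctan (1 / 44) = arctan (458 / 6593)"
    by (subst arctan_add) (simp_all)
  have s3: "arctan (458 / 6593) + arctan (37 / 1000) = arctan (701941 / 6576054)"
    by (subst arctan_add) (simp_all)
  have s4: "arctan (986 / 1719) + arctan (701941 / 6576054) = arctan (7690625823 / 10612123000)"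
    by (subst arctan_add) (simp_all)
  have "total_arg_bound \<le> arctan (7690625823 / 10612123000)"
    using \<tau>_le s1 s2 s3 s4 unfolding total_arg_bound_def \<tau>_def by linarith
  also have "\<dots> \<le> arctan (29 / 40)" by (simp add: arctan_le_iff)
  finally have le: "total_arg_bound \<le> arctan (29 / 40)" .
  have d1: "2 * arctan (29 / 40) = arctan (2320 / 759)"
    by (subst arctan_double) (simp_all add: power2_eq_square)
  have d2: "2 * arctan (759 / 2320) = arctan (3521760 / 4806319)"
    by (subst arctan_double) (simp_all add: power2_eq_square)
  have "arctan (759 / 2320) = pi / 2 - arctan (2320 / 759)"
    using arctan_inverse[of "2320 / 759"] by simp
  moreover have "arctan (29 / 40) < arctan (3521760 / 4806319)" by (simp add: arctan_less_iff)
  ultimately show ?thesis using le d1 d2 by linarith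
qed

theorem euler_ratio_power_neq_minus_one:
  assumes x: "x \<in> admissible" and k: "k \<le> 5" and nz: "euler_ratio x \<noteq> 0"
  shows "euler_ratio x ^ k \<noteq> -1"
proof (rule power_neq_minus_one)
  have nn: "total_arg_bound \<ge> 0" by (simp add: total_arg_bound_def)
  have "partial_ratio N x \<in> sector total_arg_bound" for N
  proof -
    have "partial_ratio N x \<in> sector (\<Sum>p\<in>primes_below N. arg_bound p)"
      unfolding partial_ratio_def
      using x by (intro sector_prod local_factor_in_sector) (auto simp: primes_below_def admissible_def)
    then show ?thesis using sector_mono[OF sum_arg_bound_le] by blast
  qed
  then have "Re (partial_ratio N x) \<ge> cos total_arg_bound * norm (partial_ratio N x)" for N
    using total_arg_bound_less nn by (intro sector_Re_ge) auto
  then show "Re (euler_ratio x) \<ge> cos total_arg_bound * norm (euler_ratio x)"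
    using partial_ratio_tendsto[OF x]
    by (intro LIMSEQ_le[of "\<lambda>N. cos total_arg_bound * norm (partial_ratio N x)" _ "\<lambda>N. Re (partial_ratio N x)"])
       (auto intro!: tendsto_mult tendsto_norm tendsto_Re)
  show "0 \<le> total_arg_bound" by (rule nn)
  show "total_arg_bound \<le> pi" using total_arg_bound_less nn by linarith
  have "real k * total_arg_bound \<le> 5 * total_arg_bound" using k nn by (intro mult_right_mono) auto
  then show "real k * total_arg_bound < pi" using total_arg_bound_less by linarith
qed

section \<open>Solving for the factor at the prime 2\<close>

text \<open>Solving \<open>local_factor x = 1 + v\<close> for \<open>x\<close> means solving \<open>x^2 - v x - v = 0\<close>.  A single root cannot be followed continuously
  in \<open>v\<close>, but the larger of the two moduli can: the sum \<open>b\<close> and the product \<open>|v|^2\<close> of the squared moduli are continuous, and this is the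
  larger root of the corresponding quadratic equation.\<close>
definition max_root_sq :: "complex \<Rightarrow> real" where
  "max_root_sq v = (let b = ((norm v)\<^sup>2 + norm (v\<^sup>2 + 4 * v)) / 2 in (b + sqrt (b\<^sup>2 - 4 * (norm v)\<^sup>2)) / 2)"

lemma continuous_on_max_root_sq: "continuous_on UNIV max_root_sq"
  unfolding max_root_sq_def Let_def by (intro continuous_intros) auto

text \<open>The parallelogram law gives the sum of the squared moduli of the two roots.\<close>
lemma max_root_sq:
  shows "\<exists>x. x\<^sup>2 = v * (1 + x) \<and> (norm x)\<^sup>2 = max_root_sq v"
    and "y\<^sup>2 = v * (1 + y) \<Longrightarrow> (norm y)\<^sup>2 \<le> max_root_sq v"
proof -
  define q where "q = csqrt (v\<^sup>2 + 4 * v)"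
  have q2: "q\<^sup>2 = v\<^sup>2 + 4 * v" by (simp add: q_def)
  define x1 where "x1 = (v + q) / 2"
  define x2 where "x2 = (v - q) / 2"
  define s1 where "s1 = (norm x1)\<^sup>2"
  define s2 where "s2 = (norm x2)\<^sup>2"
  define b where "b = ((norm v)\<^sup>2 + norm (v\<^sup>2 + 4 * v)) / 2"
  have root: "y\<^sup>2 - v * (1 + y) = (y - x1) * (y - x2)" for y
    using q2 by (simp add: x1_def x2_def power2_eq_square field_simps)
  have "x1 * x2 = - v"
    using q2 by (simp add: x1_def x2_def power2_eq_square field_simps)
  then have "norm x1 * norm x2 = norm v" by (metis norm_minus_cancel norm_mult)
  then have prod: "s1 * s2 = (norm v)\<^sup>2" by (simp add: s1_def s2_def power_mult_distrib[symmetric])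
  have "norm (v\<^sup>2 + 4 * v) = (norm q)\<^sup>2" by (metis norm_power q2)
  moreover have "(norm (v + q))\<^sup>2 + (norm (v - q))\<^sup>2 = 2 * (norm v)\<^sup>2 + 2 * (norm q)\<^sup>2"
    unfolding cmod_power2 by (simp add: power2_eq_square algebra_simps)
  ultimately have sum: "s1 + s2 = b"
    by (simp add: s1_def s2_def b_def x1_def x2_def norm_divide power_divide)
  have "b\<^sup>2 - 4 * (norm v)\<^sup>2 = (s1 - s2)\<^sup>2"
    unfolding sum[symmetric] prod[symmetric] by (simp add: power2_eq_square algebra_simps)
  then have max: "max_root_sq v = max s1 s2"
    unfolding max_root_sq_def Let_def b_def[symmetric] sum[symmetric] by simp
  show "\<exists>x. x\<^sup>2 = v * (1 + x) \<and> (norm x)\<^sup>2 = max_root_sq v"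
    using root[of x1] root[of x2] unfolding max
    by (cases "s1 \<le> s2") (auto simp: s1_def s2_def)
  assume "y\<^sup>2 = v * (1 + y)"
  then have "y = x1 \<or> y = x2" using root[of y] by simp
  then show "(norm y)\<^sup>2 \<le> max_root_sq v" unfolding max by (auto simp: s1_def s2_def)
qed

lemma max_root_sq_small:
  assumes r: "r > 0" and v: "norm v * (1 + r) < r\<^sup>2"
  shows "max_root_sq v < r\<^sup>2"
proof (rule ccontr)
  assume neg: "\<not> ?thesis"
  obtain x where x: "x\<^sup>2 = v * (1 + x)" "(norm x)\<^sup>2 = max_root_sq v"
    using max_root_sq(1) by blast
  have "r\<^sup>2 \<le> (norm x)\<^sup>2" using neg x by simp
  then have rx: "r \<le> norm x" by (rule power2_le_imp_le) simp
  have "norm (1 + x) \<le> 1 + norm x" using norm_triangle_ineq[of 1 x] by simp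
  then have "(norm x)\<^sup>2 \<le> norm v * (1 + norm x)"
    using arg_cong[OF x(1), of norm] by (simp add: norm_mult norm_power mult_left_mono)
  then have "(norm x)\<^sup>2 * (1 + r) \<le> (norm v * (1 + r)) * (1 + norm x)"
    using mult_right_mono[of "(norm x)\<^sup>2" "norm v * (1 + norm x)" "1 + r"] r by (simp add: mult_ac)
  also have "\<dots> < r\<^sup>2 * (1 + norm x)"
    using v r by (intro mult_strict_right_mono) (auto intro: add_pos_nonneg)
  finally have "(norm x - r) * (norm x + r + r * norm x) < 0"
    by (simp add: power2_eq_square algebra_simps)
  moreover have "(norm x - r) * (norm x + r + r * norm x) \<ge> 0"
    using rx r by (intro mult_nonneg_nonneg add_nonneg_nonneg) auto
  ultimately show False by simp
qed

text \<open>The value \<open>7 / 6\<close> is attained at \<open>x = 1 / 2\<close>.  With \<open>N = |x|^2\<close> and \<open>s = 2 Re x\<close> the claim is a quadratic inequality on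
  \<open>-N \<le> s \<le> 1\<close>, \<open>s^2 \<le> 4 N \<le> 1\<close>, where the lower bound on \<open>s\<close> is the hypothesis on \<open>1 + x\<close>.\<close>
lemma norm_local_factor_le:
  assumes x: "norm x \<le> 1 / 2" and x1: "norm (1 + x) \<ge> 1"
  shows "norm (local_factor x) \<le> 7 / 6"
proof -
  define N where "N = (norm x)\<^sup>2"
  define s where "s = 2 * Re x"
  have N: "0 \<le> N" "N \<le> 1 / 4"
    using x power_mono[OF x, of 2] by (auto simp: N_def power2_eq_square)
  have N1: "(norm (1 + x))\<^sup>2 = 1 + s + N"
    unfolding N_def s_def cmod_power2 by (simp add: power2_eq_square algebra_simps)
  have N2: "(norm (1 + x + x\<^sup>2))\<^sup>2 = 1 - N + N\<^sup>2 + s + s * N + s\<^sup>2"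
    unfolding N_def s_def cmod_power2 by (simp add: power2_eq_square algebra_simps)
  have "(norm (1 + x))\<^sup>2 \<ge> 1\<^sup>2" using x1 by (intro power_mono) auto
  then have s_ge: "s \<ge> - N" unfolding N1 by simp
  have "\<bar>Re x\<bar> \<le> 1 / 2" using abs_Re_le_cmod[of x] x by linarith
  then have s_le: "s \<le> 1" by (simp add: s_def)
  have sN: "s\<^sup>2 \<le> 4 * N"
    unfolding N_def s_def cmod_power2 by (simp add: power2_eq_square)
  have "1 - N + N\<^sup>2 + s + s * N + s\<^sup>2 \<le> 49 / 36 * (1 + s + N)"
  proof (cases "s \<ge> 0")
    case True
    have "s * N \<le> s * (1 / 4)" using True N by (intro mult_left_mono) auto
    moreover have "N * N \<le> N * (1 / 4)" using N by (intro mult_left_mono) auto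
    moreover have "s * s \<le> s * 1" using True s_le by (intro mult_left_mono) auto
    moreover have "s * s \<le> 4 * N" using sN by (simp add: power2_eq_square)
    ultimately have "36 * (s * s) + 36 * (s * N) + 36 * (N * N) \<le> 13 + 13 * s + 85 * N"
      using s_le by linarith
    then show ?thesis by (simp add: power2_eq_square algebra_simps)
  next
    case False
    have "s * N \<le> 0" using False N by (simp add: mult_nonpos_nonneg)
    moreover have "s * s \<le> N * N" using False s_ge mult_mono[of "- s" N "- s" N] by simp
    moreover have "N * N \<le> N * (1 / 4)" using N by (intro mult_left_mono) auto
    ultimately have "36 * (s * s) + 36 * (s * N) + 36 * (N * N) \<le> 13 + 13 * s + 85 * N"
      using N s_ge by linarith
    then show ?thesis by (simp add: power2_eq_square algebra_simps)
  qed
  then have "(norm (1 + x + x\<^sup>2))\<^sup>2 \<le> (7 / 6 * norm (1 + x))\<^sup>2"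
    unfolding N2 power_mult_distrib N1 by (simp add: power2_eq_square)
  then have le: "norm (1 + x + x\<^sup>2) \<le> 7 / 6 * norm (1 + x)" by (rule power2_le_imp_le) simp
  have "1 + x \<noteq> 0" using x1 by auto
  then have "local_factor x = (1 + x + x\<^sup>2) / (1 + x)"
    by (simp add: local_factor_def add_divide_distrib[of "1 + x"])
  then show ?thesis using le x1 by (simp add: norm_divide divide_le_eq)
qed

text \<open>The two roots satisfy \<open>(1 + x) (1 + y) = 1\<close>, so for one of them \<open>1 + x\<close> has modulus at least \<open>1\<close>, and if that root had modulus at most \<open>1 / 2\<close>,
  the preceding bound would apply to it.\<close>
lemma max_root_sq_large:
  assumes w: "norm (1 + v) > 7 / 6"
  shows "max_root_sq v > 1 / 4"
proof (rule ccontr)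
  assume neg: "\<not> ?thesis"
  have contra: False if y: "y\<^sup>2 = v * (1 + y)" "norm (1 + y) \<ge> 1" for y
  proof -
    have "(norm y)\<^sup>2 \<le> (1 / 2)\<^sup>2" using max_root_sq(2)[OF y(1)] neg by (simp add: power2_eq_square)
    then have "norm y \<le> 1 / 2" by (rule power2_le_imp_le) simp
    then have "norm (local_factor y) \<le> 7 / 6" using y(2) by (rule norm_local_factor_le)
    moreover have "local_factor y = 1 + v"
    proof -
      have "1 + y \<noteq> 0" using y(2) by auto
      then show ?thesis using y(1) by (simp add: local_factor_def)
    qed
    ultimately show False using w by simp
  qed
  obtain x where x: "x\<^sup>2 = v * (1 + x)" "(norm x)\<^sup>2 = max_root_sq v"
    using max_root_sq(1) by blast
  show False
  proof (cases "norm (1 + x) \<ge> 1")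
    case True
    then show ?thesis using contra x by blast
  next
    case False
    have "(norm x)\<^sup>2 \<le> (1 / 2)\<^sup>2" using x neg by (simp add: power2_eq_square)
    then have "norm x \<le> 1 / 2" by (rule power2_le_imp_le) simp
    then have nz: "1 + x \<noteq> 0" by (intro one_plus_nonzero) simp
    define y where "y = - x / (1 + x)"
    have y1: "1 + y = 1 / (1 + x)" using nz by (simp add: y_def field_simps)
    have "y\<^sup>2 = x\<^sup>2 / (1 + x)\<^sup>2" by (simp add: y_def power_divide)
    also have "\<dots> = v * (1 + y)" using nz x(1) by (simp add: y1 power2_eq_square)
    finally have "y\<^sup>2 = v * (1 + y)" .
    moreover have "norm (1 + y) \<ge> 1" using False nz by (simp add: y1 norm_divide)
    ultimately show ?thesis using contra by blast
  qed
qed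

text \<open>The intermediate value argument: along a connected family the larger root modulus passes through every value between
  two of its values.\<close>
lemma root_of_given_modulus:
  fixes f :: "'a :: topological_space \<Rightarrow> complex"
  assumes conn: "connected S" and cont: "continuous_on S f" and "r > 0"
    and a: "a \<in> S" "max_root_sq (f a) < r\<^sup>2" and b: "b \<in> S" "r\<^sup>2 < max_root_sq (f b)"
  shows "\<exists>c\<in>S. \<exists>x. norm x = r \<and> x\<^sup>2 = f c * (1 + x)"
proof -
  have "continuous_on S (\<lambda>c. max_root_sq (f c))"
    using continuous_on_compose2[OF continuous_on_max_root_sq cont] by simp
  then have "connected ((\<lambda>c. max_root_sq (f c)) ` S)" using conn by (rule connected_continuous_image)
  from connectedD_interval[OF this, of "max_root_sq (f a)" "max_root_sq (f b)" "r\<^sup>2"] a b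
  obtain c where c: "c \<in> S" "r\<^sup>2 = max_root_sq (f c)" by auto
  obtain x where "x\<^sup>2 = f c * (1 + x)" "(norm x)\<^sup>2 = r\<^sup>2" using max_root_sq(1)[of "f c"] c by metis
  then show ?thesis using c \<open>r > 0\<close> by (intro bexI[of _ c] exI[of _ x] conjI) (auto intro: power2_eq_imp_eq)
qed

section \<open>The primes from 11 on\<close>

lemma sum_inverse_square_odd_tail:
  "(\<Sum>p | prime p \<and> 11 \<le> p \<and> p < 2 * m + 11. 1 / real p ^ 2) \<le> 1 / 20 - 1 / (2 * (2 * real m + 10))"
proof (induction m)
  case 0
  have "{p::nat. prime p \<and> 11 \<le> p \<and> p < 2 * 0 + 11} = {}" by auto
  then show ?case by (simp only: sum.empty) simp
next
  case (Suc m)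
  let ?S = "{p. prime p \<and> 11 \<le> p \<and> p < 2 * m + 11}"
  have sub: "{p. prime p \<and> 11 \<le> p \<and> p < 2 * Suc m + 11} \<subseteq> ?S \<union> {2 * m + 11}"
  proof
    fix p assume "p \<in> {p. prime p \<and> 11 \<le> p \<and> p < 2 * Suc m + 11}"
    then have p: "prime p" "11 \<le> p" "p < 2 * m + 13" by auto
    have "\<not> 2 dvd p" using p primes_dvd_imp_eq[of 2 p] by auto
    then have "p \<noteq> 2 * m + 12" by auto
    with p show "p \<in> ?S \<union> {2 * m + 11}" by auto
  qed
  have "(\<Sum>p | prime p \<and> 11 \<le> p \<and> p < 2 * Suc m + 11. 1 / real p ^ 2)
        \<le> (\<Sum>p\<in>?S \<union> {2 * m + 11}. 1 / real p ^ 2)"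
    by (rule sum_mono2[OF _ sub]) auto
  also have "\<dots> = (\<Sum>p\<in>?S. 1 / real p ^ 2) + 1 / real (2 * m + 11) ^ 2"
    by (subst sum.union_disjoint) auto
  also have "1 / real (2 * m + 11) ^ 2 \<le> 1 / (2 * (2 * real m + 10)) - 1 / (2 * (2 * real (Suc m) + 10))"
  proof -
    have "1 / (2 * (2 * real m + 10)) - 1 / (2 * (2 * real (Suc m) + 10)) = 1 / ((2 * real m + 10) * (2 * real m + 12))"
    proof -
      define u where "u = 2 * real m + 10"
      have "u > 0" by (simp add: u_def)
      then have "1 / (2 * u) - 1 / (2 * (u + 2)) = 1 / (u * (u + 2))" by (simp add: divide_simps)
      then show ?thesis by (simp add: u_def algebra_simps)
    qed
    moreover have "1 / real (2 * m + 11) ^ 2 \<le> 1 / ((2 * real m + 10) * (2 * real m + 12))"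
    proof (rule frac_le)
      show "(2 * real m + 10) * (2 * real m + 12) \<le> real (2 * m + 11) ^ 2"
        by (simp add: power2_eq_square algebra_simps)
      show "0 < (2 * real m + 10) * (2 * real m + 12)" by (intro mult_pos_pos) auto
    qed auto
    ultimately show ?thesis by simp
  qed
  finally show ?case using Suc.IH by linarith
qed

lemma sum_inverse_square_tail:
  "(\<Sum>p\<in>primes_below N. if 11 \<le> p then 1 / real p ^ 2 else 0) \<le> 1 / 20"
proof -
  have "(\<Sum>p\<in>primes_below N. if 11 \<le> p then 1 / real p ^ 2 else 0)
        = (\<Sum>p | p \<in> primes_below N \<and> 11 \<le> p. 1 / real p ^ 2)"
    by (rule sum.inter_filter[symmetric]) simp
  also have "\<dots> \<le> (\<Sum>p | prime p \<and> 11 \<le> p \<and> p < 2 * N + 11. 1 / real p ^ 2)"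
    by (rule sum_mono2) (auto simp: primes_below_def)
  also have "\<dots> \<le> 1 / 20 - 1 / (2 * (2 * real N + 10))" by (rule sum_inverse_square_odd_tail)
  also have "\<dots> \<le> 1 / 20" by simp
  finally show ?thesis .
qed

text \<open>On the imaginary axis the local factor is explicit: its modulus is slightly below \<open>1\<close> and its argument is only of
  order \<open>r^3\<close>.\<close>
lemma local_factor_imaginary:
  "local_factor (\<i> * of_real r) = Complex 1 (r ^ 3) / of_real (1 + r\<^sup>2)"
proof -
  have "1 + \<i> * of_real r \<noteq> 0" by (simp add: complex_eq_iff)
  moreover have "complex_of_real (1 + r\<^sup>2) \<noteq> 0"
    by (metis of_real_eq_0_iff add_pos_nonneg less_irrefl zero_le_power2 zero_less_one)
  moreover have "(1 + \<i> * of_real r + (\<i> * of_real r)\<^sup>2) * of_real (1 + r\<^sup>2) = Complex 1 (r ^ 3) * (1 + \<i> * of_real r)"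
    by (simp add: complex_eq_iff power2_eq_square power3_eq_cube algebra_simps)
  ultimately have "(1 + \<i> * of_real r + (\<i> * of_real r)\<^sup>2) / (1 + \<i> * of_real r) = Complex 1 (r ^ 3) / of_real (1 + r\<^sup>2)"
    by (simp add: frac_eq_eq)
  then show ?thesis
    using \<open>1 + \<i> * of_real r \<noteq> 0\<close>
    by (simp only: local_factor_def add_divide_distrib[of "1 + \<i> * of_real r"]) simp
qed

lemma norm_local_factor_imaginary:
  assumes "0 \<le> r" "r \<le> 1"
  shows "norm (local_factor (\<i> * of_real r)) \<le> 1" and "1 - r\<^sup>2 \<le> norm (local_factor (\<i> * of_real r))"
proof -
  have eq: "norm (local_factor (\<i> * of_real r)) = sqrt (1 + (r ^ 3)\<^sup>2) / (1 + r\<^sup>2)"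
    unfolding local_factor_imaginary norm_divide norm_of_real
    by (simp add: cmod_def abs_of_nonneg)
  have "(r ^ 3)\<^sup>2 = r\<^sup>2 * (r\<^sup>2 * r\<^sup>2)" by (simp add: power2_eq_square power3_eq_cube)
  also have "\<dots> \<le> r\<^sup>2 * 1"
    using assms by (intro mult_left_mono mult_le_one) (auto simp: power_le_one)
  finally have "1 + (r ^ 3)\<^sup>2 \<le> 1 + 2 * r\<^sup>2 + (r\<^sup>2)\<^sup>2"
    using zero_le_power2[of r] zero_le_power2[of "r\<^sup>2"] by linarith
  also have "\<dots> = (1 + r\<^sup>2)\<^sup>2" by (simp add: power2_sum)
  finally have "sqrt (1 + (r ^ 3)\<^sup>2) \<le> 1 + r\<^sup>2"
    by (intro real_le_lsqrt) auto
  then show "norm (local_factor (\<i> * of_real r)) \<le> 1"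
    unfolding eq by (simp add: divide_le_eq add_pos_nonneg)
  have "1 - r\<^sup>2 \<le> 1 / (1 + r\<^sup>2)"
    by (simp add: le_divide_eq add_pos_nonneg algebra_simps)
  also have "\<dots> \<le> norm (local_factor (\<i> * of_real r))"
    unfolding eq by (intro divide_right_mono) auto
  finally show "1 - r\<^sup>2 \<le> norm (local_factor (\<i> * of_real r))" .
qed

text \<open>All primes from \<open>11\<close> on receive the fixed phase \<open>\<i>\<close>.  The value \<open>0\<close> at the smaller primes makes their local
  factors equal to \<open>1\<close>.\<close>
definition tail_seq :: "real \<Rightarrow> nat \<Rightarrow> complex" where
  "tail_seq \<sigma> p = (if 11 \<le> p then \<i> * of_real (real p powr - \<sigma>) else 0)"

lemma powr_le_inverse:
  assumes "\<sigma> \<ge> 1" "p \<ge> 1"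
  shows "real p powr - \<sigma> \<le> 1 / real p"
proof -
  have "real p powr - \<sigma> \<le> real p powr - 1" using assms by (intro powr_mono) auto
  then show ?thesis using assms by (simp add: powr_minus_divide)
qed

lemma tail_seq_admissible: "\<sigma> \<ge> 1 \<Longrightarrow> tail_seq \<sigma> \<in> admissible"
  by (auto simp: admissible_def tail_seq_def norm_mult intro!: powr_le_inverse)

text \<open>The whole tail is almost a real number in \<open>[19/20, 1]\<close>: the moduli lose at most the sum of \<open>1 / p^2\<close>, which is
  below \<open>1/20\<close> for odd \<open>p \<ge> 11\<close>, and the arguments add up to at most the sum of \<open>1 / p^3\<close>, which is below \<open>1/220\<close>.\<close>
lemma euler_ratio_tail_seq:
  assumes \<sigma>: "\<sigma> \<ge> 1"
  defines "T \<equiv> euler_ratio (tail_seq \<sigma>)"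
  shows "norm T \<le> 1" and "19 / 20 \<le> norm T" and "norm (T - of_real (norm T)) \<le> norm T / 200"
proof -
  have lim: "(\<lambda>N. partial_ratio N (tail_seq \<sigma>)) \<longlonglongrightarrow> T"
    unfolding T_def by (rule partial_ratio_tendsto[OF tail_seq_admissible[OF \<sigma>]])
  define a :: "nat \<Rightarrow> real" where "a p = (if 11 \<le> p then 1 / real p ^ 2 else 0)" for p
  have lf0: "local_factor 0 = 1" by (simp add: local_factor_def)
  have fac: "norm (local_factor (tail_seq \<sigma> p)) \<le> 1 \<and> 1 - a p \<le> norm (local_factor (tail_seq \<sigma> p))
      \<and> local_factor (tail_seq \<sigma> p) \<in> sector (a p / 11)" for p
  proof (cases "11 \<le> p")
    case False
    then show ?thesis by (auto simp: tail_seq_def a_def lf0 sector_def intro!: exI[of _ 1] exI[of _ "0::real"])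
  next
    case True
    define r where "r = real p powr - \<sigma>"
    have r: "0 < r" "r \<le> 1 / real p" using True powr_le_inverse[OF \<sigma>, of p] by (auto simp: r_def)
    have "1 / real p \<le> 1 / 11" using True by (intro divide_left_mono) auto
    then have r11: "r \<le> 1 / 11" using r by linarith
    have x: "tail_seq \<sigma> p = \<i> * of_real r" using True by (simp add: tail_seq_def r_def)
    have r2: "r\<^sup>2 \<le> a p"
      using power_mono[OF r(2), of 2] r True by (simp add: a_def power_divide)
    have "r ^ 3 = r * r\<^sup>2" by (simp add: power2_eq_square power3_eq_cube)
    also have "\<dots> \<le> 1 / 11 * a p" using r r11 r2 by (intro mult_mono) auto
    finally have r3: "r ^ 3 \<le> a p / 11" by simp
    have "local_factor (tail_seq \<sigma> p) \<in> sector (arctan (r ^ 3))"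
      unfolding x local_factor_imaginary
      using r by (intro mem_sector_arctan) (auto simp: add_pos_nonneg)
    moreover have "arctan (r ^ 3) \<le> a p / 11"
      using r r3 by (intro order_trans[OF arctan_le_self]) auto
    ultimately have "local_factor (tail_seq \<sigma> p) \<in> sector (a p / 11)"
      using sector_mono by blast
    moreover have "norm (local_factor (tail_seq \<sigma> p)) \<le> 1"
      unfolding x using r r11 by (intro norm_local_factor_imaginary(1)) auto
    moreover have "1 - r\<^sup>2 \<le> norm (local_factor (tail_seq \<sigma> p))"
      unfolding x using r r11 by (intro norm_local_factor_imaginary(2)) auto
    ultimately show ?thesis using r2 by auto
  qed
  have suma: "(\<Sum>p\<in>primes_below N. a p) \<le> 1 / 20" for N
    unfolding a_def by (rule sum_inverse_square_tail)
  have a01: "0 \<le> a p" "a p \<le> 1" if "p \<in> primes_below N" for p N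
    using that by (auto simp: a_def primes_below_def divide_le_eq)
  have n1: "norm (partial_ratio N (tail_seq \<sigma>)) \<le> 1" for N
    unfolding partial_ratio_def prod_norm[symmetric] using fac by (intro prod_le_1) auto
  have n2: "19 / 20 \<le> norm (partial_ratio N (tail_seq \<sigma>))" for N
  proof -
    have "19 / 20 \<le> 1 - (\<Sum>p\<in>primes_below N. a p)" using suma[of N] by simp
    also have "\<dots> \<le> (\<Prod>p\<in>primes_below N. 1 - a p)"
      using a01 by (intro Weierstrass_prod_ineq) auto
    also have "\<dots> \<le> norm (partial_ratio N (tail_seq \<sigma>))"
      unfolding partial_ratio_def prod_norm[symmetric] using fac a01 by (intro prod_mono) auto
    finally show ?thesis .
  qed
  have sec: "partial_ratio N (tail_seq \<sigma>) \<in> sector (1 / 200)" for N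
  proof -
    have "partial_ratio N (tail_seq \<sigma>) \<in> sector (\<Sum>p\<in>primes_below N. a p / 11)"
      unfolding partial_ratio_def using fac by (intro sector_prod) auto
    moreover have "(\<Sum>p\<in>primes_below N. a p / 11) \<le> 1 / 200"
      using suma[of N] by (simp add: sum_divide_distrib[symmetric])
    ultimately show ?thesis using sector_mono by blast
  qed
  show le1: "norm T \<le> 1" by (rule LIMSEQ_le_const2[OF tendsto_norm[OF lim]]) (use n1 in auto)
  show "19 / 20 \<le> norm T" by (rule LIMSEQ_le_const[OF tendsto_norm[OF lim]]) (use n2 in auto)
  have "Re (partial_ratio N (tail_seq \<sigma>)) \<ge> cos (1 / 200) * norm (partial_ratio N (tail_seq \<sigma>))" for N
    using sec pi_gt3 by (intro sector_Re_ge) auto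
  then have Re: "Re T \<ge> cos (1 / 200) * norm T"
    by (intro LIMSEQ_le[OF tendsto_mult[OF tendsto_const tendsto_norm[OF lim]] tendsto_Re[OF lim]]) auto
  have "cos (1 / 200 :: real) \<ge> 1 - 2 * (1 / 400)\<^sup>2"
    using cos_ge[of "1 / 200"] by (simp add: power2_eq_square)
  then have "(1 - 2 * (1 / 400)\<^sup>2) * norm T \<le> cos (1 / 200) * norm T" by (intro mult_right_mono) auto
  with Re have "(1 - 2 * (1 / 400)\<^sup>2) * norm T \<le> Re T" by linarith
  then have "norm T * ((1 - 2 * (1 / 400)\<^sup>2) * norm T) \<le> norm T * Re T" by (intro mult_left_mono) auto
  moreover have "(norm (T - of_real (norm T)))\<^sup>2 = 2 * (norm T)\<^sup>2 - 2 * (norm T * Re T)"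
    unfolding cmod_power2[of "T - of_real (norm T)"] using cmod_power2[of T]
    by (simp add: power2_eq_square algebra_simps)
  ultimately have "(norm (T - of_real (norm T)))\<^sup>2 \<le> (norm T / 200)\<^sup>2"
    by (simp add: power2_eq_square algebra_simps)
  then show "norm (T - of_real (norm T)) \<le> norm T / 200" by (rule power2_le_imp_le) simp
qed

lemma euler_ratio_split:
  assumes x: "x \<in> admissible" and F: "finite F" "\<And>p. p \<in> F \<Longrightarrow> prime p"
  shows "euler_ratio x = (\<Prod>p\<in>F. local_factor (x p)) * euler_ratio (\<lambda>p. if p \<in> F then 0 else x p)"
proof -
  define y where "y = (\<lambda>p. if p \<in> F then 0 else x p)"
  have y: "y \<in> admissible" using x by (auto simp: admissible_def y_def)
  obtain M where M: "\<And>p. p \<in> F \<Longrightarrow> p < M" using F(1) by (meson finite_nat_set_iff_bounded)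
  have "partial_ratio N x = (\<Prod>p\<in>F. local_factor (x p)) * partial_ratio N y" if "N \<ge> M" for N
  proof -
    have sub: "F \<subseteq> primes_below N" using M F(2) that by (force simp: primes_below_def)
    have "(\<Prod>p\<in>F. local_factor (y p)) = 1" by (intro prod.neutral) (auto simp: y_def local_factor_def)
    moreover have "(\<Prod>p\<in>primes_below N - F. local_factor (y p)) = (\<Prod>p\<in>primes_below N - F. local_factor (x p))"
      by (intro prod.cong) (auto simp: y_def)
    ultimately show ?thesis
      unfolding partial_ratio_def prod.subset_diff[OF sub finite_primes_below] by simp
  qed
  then have ev: "\<forall>\<^sub>F N in sequentially. (\<Prod>p\<in>F. local_factor (x p)) * partial_ratio N y = partial_ratio N x"
    by (intro eventually_sequentiallyI[of M]) simp
  have "(\<lambda>N. (\<Prod>p\<in>F. local_factor (x p)) * partial_ratio N y) \<longlonglongrightarrow> (\<Prod>p\<in>F. local_factor (x p)) * euler_ratio y"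
    by (intro tendsto_mult tendsto_const partial_ratio_tendsto y)
  then have "(\<lambda>N. partial_ratio N x) \<longlonglongrightarrow> (\<Prod>p\<in>F. local_factor (x p)) * euler_ratio y"
    using ev by (rule Lim_transform_eventually)
  with partial_ratio_tendsto[OF x] show ?thesis unfolding y_def by (rule LIMSEQ_unique)
qed

section \<open>Attaining a prescribed value by moving the phases at 3, 5 and 7\<close>

text \<open>The factors at \<open>3, 5, 7\<close> as a function of their phases; these are the variables of the intermediate value argument.\<close>
definition head_factor :: "real \<Rightarrow> complex \<times> complex \<times> complex \<Rightarrow> complex" where
  "head_factor \<sigma> = (\<lambda>(z3, z5, z7). local_factor (of_real (3 powr - \<sigma>) * z3)
     * local_factor (of_real (5 powr - \<sigma>) * z5) * local_factor (of_real (7 powr - \<sigma>) * z7))"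

lemma local_factor_nonzero: "norm x \<le> 1 / 2 \<Longrightarrow> local_factor x \<noteq> 0"
  using norm_local_factor_minus_1[of x "1 / 2"]
  by (auto simp: power2_eq_square)

lemma powr_le_half: 
  assumes "\<sigma> \<ge> 1" "q \<ge> 2" shows "real q powr - \<sigma> \<le> 1 / 2"
proof -
  have "1 / real q \<le> 1 / 2" using assms by (intro divide_left_mono) auto
  moreover have "real q powr - \<sigma> \<le> 1 / real q" using assms by (intro powr_le_inverse) auto
  ultimately show ?thesis by linarith
qed

abbreviation torus :: "(complex \<times> complex \<times> complex) set" where
  "torus \<equiv> sphere 0 1 \<times> sphere 0 1 \<times> sphere 0 1"

lemma connected_torus: "connected torus"
  by (intro connected_Times connected_sphere) auto

lemma head_factor_nonzero:
  assumes "\<sigma> \<ge> 1" "z \<in> torus"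
  shows "head_factor \<sigma> z \<noteq> 0"
proof -
  obtain z3 z5 z7 where z: "z = (z3, z5, z7)" by (cases z) auto
  with assms have n: "norm z3 = 1" "norm z5 = 1" "norm z7 = 1" by auto
  have "local_factor (of_real (real q powr - \<sigma>) * u) \<noteq> 0" if "norm u = 1" "q \<ge> 2" for u q
    using powr_le_half[OF assms(1) that(2)] that(1) by (intro local_factor_nonzero) (simp add: norm_mult)
  from this[OF n(1), of 3] this[OF n(2), of 5] this[OF n(3), of 7] show ?thesis
    by (simp add: z head_factor_def)
qed

lemma continuous_on_head_factor:
  assumes "\<sigma> \<ge> 1"
  shows "continuous_on torus (head_factor \<sigma>)"
  unfolding head_factor_def case_prod_unfold
  using powr_le_half[OF assms, of 3] powr_le_half[OF assms, of 5] powr_le_half[OF assms, of 7]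
  by (intro continuous_intros continuous_on_compose2[OF continuous_on_local_factor])
     (auto simp: norm_mult)

text \<open>For given phases at \<open>3, 5, 7\<close> the factor at \<open>2\<close> has to take the value \<open>Z / (head_factor \<sigma> z * T)\<close>.  At the starting phases this
  is so close to \<open>1\<close> that both solutions \<open>x\<close> have modulus below \<open>2 powr -\<sigma>\<close>; when all phases are \<open>\<i>\<close> its modulus exceeds \<open>7 / 6\<close> and one
  solution has a larger modulus.  In between, some solution has modulus exactly \<open>2 powr -\<sigma>\<close>.\<close>
lemma euler_ratio_attains:
  fixes Z :: complex
  assumes \<sigma>: "\<sigma> > 1" and Z: "norm Z = 1"
    and start: "s \<in> torus" "norm (Z / (head_factor \<sigma> s * euler_ratio (tail_seq \<sigma>)) - 1) * (1 + 2 powr - \<sigma>) < (2 powr - \<sigma>)\<^sup>2"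
    and stop: "norm (head_factor \<sigma> (\<i>, \<i>, \<i>)) < 6 / 7"
  obtains \<omega> where "\<And>p. norm (\<omega> p) = 1"
    "euler_ratio (\<lambda>p. \<omega> p * of_real (real p powr - \<sigma>)) = Z"
proof -
  define T where "T = euler_ratio (tail_seq \<sigma>)"
  define r where "r = 2 powr - \<sigma>"
  have r: "0 < r" "r \<le> 1 / 2" using powr_le_half[of \<sigma> 2] \<sigma> by (auto simp: r_def)
  have T: "norm T \<le> 1" "T \<noteq> 0"
    using euler_ratio_tail_seq[of \<sigma>] \<sigma> unfolding T_def by auto
  define f where "f z = Z / (head_factor \<sigma> z * T) - 1" for z
  have nz: "head_factor \<sigma> z * T \<noteq> 0" if "z \<in> torus" for z
    using head_factor_nonzero[OF _ that, of \<sigma>] \<sigma> T by simp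
  have cont: "continuous_on torus f"
    unfolding f_def using nz \<sigma> by (intro continuous_intros continuous_on_head_factor) auto
  have "norm (f s) * (1 + r) < r\<^sup>2" using start unfolding f_def T_def r_def by simp
  then have "max_root_sq (f s) < r\<^sup>2" using r by (intro max_root_sq_small) auto
  moreover have "r\<^sup>2 < max_root_sq (f (\<i>, \<i>, \<i>))"
  proof -
    let ?h = "norm (head_factor \<sigma> (\<i>, \<i>, \<i>)) * norm T"
    have "?h \<le> norm (head_factor \<sigma> (\<i>, \<i>, \<i>)) * 1" using T by (intro mult_left_mono) auto
    then have "?h < 6 / 7" using stop by simp
    moreover have "?h > 0" using nz[of "(\<i>, \<i>, \<i>)"] by simp
    ultimately have "7 / 6 < 1 / ?h" by (simp add: field_simps)
    also have "\<dots> = norm (1 + f (\<i>, \<i>, \<i>))" by (simp add: f_def norm_divide norm_mult Z)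
    finally have "1 / 4 < max_root_sq (f (\<i>, \<i>, \<i>))" by (rule max_root_sq_large)
    moreover have "r\<^sup>2 \<le> (1 / 2)\<^sup>2" using r by (intro power_mono) auto
    ultimately show ?thesis by (simp add: power2_eq_square)
  qed
  ultimately obtain z x where z: "z \<in> torus" and x: "norm x = r" "x\<^sup>2 = f z * (1 + x)"
    using root_of_given_modulus[OF connected_torus cont r(1) start(1), of "(\<i>, \<i>, \<i>)"] by auto
  obtain z3 z5 z7 where zz: "z = (z3, z5, z7)" by (cases z) auto
  have n: "norm z3 = 1" "norm z5 = 1" "norm z7 = 1" using z zz by auto
  have "1 + x \<noteq> 0" using x r by (intro one_plus_nonzero) auto
  then have "local_factor x = 1 + f z" using x by (simp add: local_factor_def)
  then have lfx: "local_factor x * (head_factor \<sigma> z * T) = Z"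
    using nz[OF z] by (simp add: f_def)
  define \<omega> where "\<omega> = (\<lambda>p::nat. if p = 2 then x / of_real r else if p = 3 then z3 else if p = 5 then z5
     else if p = 7 then z7 else \<i>)"
  define X where "X = (\<lambda>p. \<omega> p * of_real (real p powr - \<sigma>))"
  have unim: "norm (\<omega> p) = 1" for p using n x r by (auto simp: \<omega>_def norm_divide)
  have X: "X \<in> admissible"
    using \<sigma> by (auto simp: admissible_def X_def norm_mult unim intro!: powr_le_inverse prime_ge_1_nat)
  have "euler_ratio X = (\<Prod>p\<in>{2, 3, 5, 7}. local_factor (X p)) * euler_ratio (\<lambda>p. if p \<in> {2, 3, 5, 7} then 0 else X p)"
    by (rule euler_ratio_split[OF X]) auto
  also have "euler_ratio (\<lambda>p. if p \<in> {2, 3, 5, 7} then 0 else X p) = T"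
  proof -
    have "partial_ratio N (\<lambda>p. if p \<in> {2, 3, 5, 7} then 0 else X p) = partial_ratio N (tail_seq \<sigma>)" for N
      unfolding partial_ratio_def
    proof (rule prod.cong)
      fix p assume "p \<in> primes_below N"
      then have p: "prime p" by (simp add: primes_below_def)
      have "11 \<le> p" if "p \<notin> {2, 3, 5, 7}"
      proof (rule ccontr)
        assume "\<not> 11 \<le> p"
        then have "p \<in> {4, 6, 8, 9, 10}" using prime_ge_2_nat[OF p] that by auto
        then have "2 dvd p \<or> 3 dvd p" by auto
        then show False using p that primes_dvd_imp_eq[of 2 p] primes_dvd_imp_eq[of 3 p] by auto
      qed
      then show "local_factor (if p \<in> {2, 3, 5, 7} then 0 else X p) = local_factor (tail_seq \<sigma> p)"
        by (auto simp: tail_seq_def X_def \<omega>_def)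
    qed auto
    then show ?thesis unfolding T_def euler_ratio_def by simp
  qed
  also have "(\<Prod>p\<in>{2, 3, 5, 7}. local_factor (X p)) = local_factor x * head_factor \<sigma> z"
    using r by (simp add: X_def \<omega>_def head_factor_def zz r_def mult.commute mult.left_commute)
  also have "\<dots> * T = Z" using lfx by (simp add: mult.assoc)
  finally show ?thesis using that[of \<omega>] unim unfolding X_def by blast
qed

text \<open>Replacing the tail \<open>T\<close> by its modulus \<open>t\<close> costs \<open>1/200\<close> and leaves \<open>33/200 - 1/200 = 4/25\<close>, whence the constant
  \<open>609/625 = 1 - (4/25)^2\<close>.  The remaining inequality is quadratic and convex in \<open>t\<close>, so its two instances \<open>t = 19/20\<close> and \<open>t = 1\<close>
  are enough.  The number \<open>33/200\<close> is just below \<open>1/6\<close>, the threshold \<open>r^2 / (1 + r)\<close> at \<open>r = 1/2\<close>.\<close>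
lemma start_condition:
  fixes Z E T :: complex
  assumes Z: "norm Z = 1" and E: "E \<noteq> 0"
    and T: "norm T \<le> 1" "19 / 20 \<le> norm T" "norm (T - of_real (norm T)) \<le> norm T / 200"
    and c1: "1 + 609 / 625 * (19 / 20)\<^sup>2 * (norm E)\<^sup>2 < 2 * (19 / 20) * Re (cnj E * Z)"
    and c2: "1 + 609 / 625 * (norm E)\<^sup>2 < 2 * Re (cnj E * Z)"
  shows "norm (Z / (E * T) - 1) < 33 / 200"
proof -
  define t where "t = norm T"
  define e where "e = (norm E)\<^sup>2"
  define q where "q = Re (cnj E * Z)"
  have t: "19 / 20 \<le> t" "t \<le> 1" using T by (auto simp: t_def)
  have e: "e \<ge> 0" by (simp add: e_def)
  have conv: "1 + 609 / 625 * t\<^sup>2 * e < 2 * t * q"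
  proof -
    have "(t - 19 / 20) * (1 - t) \<ge> 0" using t by (intro mult_nonneg_nonneg) auto
    moreover have "(t - 19 / 20) * (1 - t) = 39 / 20 * t - 19 / 20 - t\<^sup>2"
      by (simp add: power2_eq_square field_simps)
    ultimately have "t\<^sup>2 \<le> 39 / 20 * t - 19 / 20" by linarith
    then have "609 / 625 * t\<^sup>2 * e \<le> 609 / 625 * (39 / 20 * t - 19 / 20) * e"
      using e by (intro mult_right_mono mult_left_mono) auto
    moreover define a where "a = 20 * t - 19"
    have a: "0 \<le> a" "a \<le> 1" "t = 19 / 20 + a / 20" using t by (auto simp: a_def field_simps)
    have "(1 - a) * (1 + 609 / 625 * (19 / 20)\<^sup>2 * e - 2 * (19 / 20) * q) + a * (1 + 609 / 625 * e - 2 * q) < 0"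
      using c1 c2 a unfolding e_def[symmetric] q_def[symmetric]
      by (cases "a = 0"; cases "a = 1") (auto intro!: add_neg_neg mult_pos_neg)
    then have "1 + 609 / 625 * (39 / 20 * t - 19 / 20) * e - 2 * t * q < 0"
      unfolding a(3) by (simp add: power2_eq_square field_simps)
    ultimately show ?thesis by linarith
  qed
  have "(norm (Z - E * of_real t))\<^sup>2 = 1 + t\<^sup>2 * e - 2 * t * q"
  proof -
    have "(norm Z)\<^sup>2 = 1" using Z by simp
    then show ?thesis unfolding e_def q_def cmod_power2
      by (simp add: power2_eq_square algebra_simps)
  qed
  also have "\<dots> < 16 / 625 * t\<^sup>2 * e" using conv unfolding mult.assoc by linarith
  also have "\<dots> = (4 / 25 * (t * norm E))\<^sup>2" by (simp add: e_def power_mult_distrib power_divide)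
  finally have "norm (Z - E * of_real t) < 4 / 25 * (t * norm E)"
    by (rule power2_less_imp_less) (use t in auto)
  moreover have "norm (E * of_real t - E * T) \<le> norm E * (t / 200)"
  proof -
    have "E * of_real t - E * T = - (E * (T - of_real t))" by (simp add: algebra_simps)
    then have "norm (E * of_real t - E * T) = norm E * norm (T - of_real t)"
      by (simp add: norm_mult)
    then show ?thesis using mult_left_mono[OF T(3), of "norm E"] by (simp add: t_def)
  qed
  moreover have "norm (Z - E * T) \<le> norm (Z - E * of_real t) + norm (E * of_real t - E * T)"
    using norm_triangle_ineq[of "Z - E * of_real t" "E * of_real t - E * T"] by simp
  ultimately have lt: "norm (Z - E * T) < 33 / 200 * (t * norm E)" by (simp add: mult_ac)
  have ET: "E * T \<noteq> 0" using E T by auto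
  have "norm (Z / (E * T) - 1) = norm (Z - E * T) / (t * norm E)"
    using ET by (simp add: diff_divide_distrib[symmetric] t_def divide_simps norm_divide norm_mult mult.commute)
  also have "\<dots> < 33 / 200" using lt E t by (simp add: divide_less_eq)
  finally show ?thesis .
qed

section \<open>The values cis (pi / k) just to the right of the line of real part 1\<close>

lemma local_factor_eqI:
  assumes "1 + x \<noteq> 0" "x\<^sup>2 = (w - 1) * (1 + x)"
  shows "local_factor x = w"
  using assms by (simp add: local_factor_def)

lemma head_factor_tendsto:
  assumes z: "z \<in> torus"
  shows "((\<lambda>\<sigma>. head_factor \<sigma> z) \<longlongrightarrow> head_factor 1 z) (at_right 1)"
proof -
  obtain z3 z5 z7 where zz: "z = (z3, z5, z7)" by (cases z) auto
  with z have n: "norm z3 = 1" "norm z5 = 1" "norm z7 = 1" by auto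
  have lf: "((\<lambda>\<sigma>. local_factor (of_real (q powr - \<sigma>) * u)) \<longlongrightarrow> local_factor (of_real (q powr - 1) * u)) (at_right 1)"
    if "norm u = 1" "q > 1" for u and q :: real
  proof (rule isCont_tendsto_compose[of _ local_factor])
    have "norm (of_real (q powr - 1) * u) < 1"
      using that by (simp add: norm_mult norm_divide powr_minus_divide)
    then show "isCont local_factor (of_real (q powr - 1) * u)"
      using continuous_on_local_factor by (simp add: continuous_on_eq_continuous_at)
    show "((\<lambda>\<sigma>. of_real (q powr - \<sigma>) * u) \<longlongrightarrow> of_real (q powr - 1) * u) (at_right 1)"
      using that by (intro tendsto_intros) auto
  qed
  show ?thesis unfolding head_factor_def zz case_prod_conv using n by (intro tendsto_mult lf) auto
qed

text \<open>At the primes \<open>3, 5, 7\<close> this phase nearly maximises the argument of the local factor, and it has rational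
  coordinates.\<close>
definition phase345 :: complex where "phase345 = Complex (- 4 / 5) (- 3 / 5)"

lemma norm_phase345: "norm phase345 = 1"
  by (simp add: phase345_def cmod_def power2_eq_square)

lemma local_factor_phase345:
  "local_factor (phase345 / 3) = Complex (391 / 390) (19 / 130)"
  "local_factor (phase345 / 5) = Complex (151 / 150) (7 / 150)"
  "local_factor (cnj phase345 / 5) = Complex (151 / 150) (- 7 / 150)"
  "local_factor (phase345 / 7) = Complex (6819 / 6790) (153 / 6790)"
  by (rule local_factor_eqI; simp add: phase345_def complex_eq_iff power2_eq_square Re_divide_numeral Im_divide_numeral)+

text \<open>Starting phases for \<open>9 \<le> k \<le> 15\<close> and for \<open>k \<ge> 16\<close>.  The product of the three factors has argument about \<open>0.214\<close> in the first case and, the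
  factor at \<open>5\<close> being conjugated, about \<open>0.121\<close> in the second; either way this differs from \<open>pi / k\<close> by less than \<open>0.136\<close>, while about \<open>1/6\<close> is
  allowed.  No single choice works for all \<open>k\<close>, because \<open>pi / 9\<close> is larger than \<open>2 * arcsin (1/6)\<close>.\<close>
definition start_small :: "complex \<times> complex \<times> complex" where "start_small = (phase345, phase345, phase345)"
definition start_large :: "complex \<times> complex \<times> complex" where "start_large = (phase345, cnj phase345, phase345)"

lemma start_torus: "start_small \<in> torus" "start_large \<in> torus"
  by (auto simp: start_small_def start_large_def norm_phase345)

lemma head_factor_start:
  "head_factor 1 start_small = Complex (9479623 / 9457500) (14387827 / 66202500)"
  "head_factor 1 start_large = Complex (77033 / 75660) (327479 / 2648100)"
  unfolding start_small_def start_large_def head_factor_def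
  by (simp_all add: powr_minus_divide local_factor_phase345 complex_eq_iff)

lemma start_small_numeric:
  fixes y :: real
  assumes y: "2094 / 10000 \<le> y" "y \<le> 3491 / 10000"
  shows "1014 / 1000 < 9479623 / 9457500 * cos y + 14387827 / 66202500 * sin y"
proof -
  have "(y - 2094 / 10000) * (3491 / 10000 - y) \<ge> 0" using y by (intro mult_nonneg_nonneg) auto
  moreover have "(y - 2094 / 10000) * (3491 / 10000 - y) = 5585 / 10000 * y - 7310154 / 100000000 - y\<^sup>2"
    by (simp add: power2_eq_square field_simps)
  ultimately have y2: "y\<^sup>2 \<le> 5585 / 10000 * y - 73 / 1000" by linarith
  have "cos y \<ge> 1 - 5585 / 20000 * y + 73 / 2000" using cos_ge[of y] y2 by linarith
  moreover have "sin y \<ge> 979 / 1000 * y"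
  proof -
    have "y\<^sup>2 \<le> (3491 / 10000)\<^sup>2" using y by (intro power_mono) auto
    then have "y * y\<^sup>2 \<le> y * (3491 / 10000)\<^sup>2" using y by (intro mult_left_mono) auto
    then have "y ^ 3 \<le> 126 / 1000 * y" using y by (simp add: power2_eq_square power3_eq_cube)
    then show ?thesis using sin_ge[of y] y by linarith
  qed
  ultimately show ?thesis using y by linarith
qed

lemma start_large_numeric:
  fixes y :: real
  assumes y: "0 \<le> y" "y \<le> 1964 / 10000"
  shows "1014 / 1000 < 77033 / 75660 * cos y + 327479 / 2648100 * sin y"
proof -
  have "y * (1964 / 10000 - y) \<ge> 0" using y by (intro mult_nonneg_nonneg) auto
  then have y2: "y\<^sup>2 \<le> 1964 / 10000 * y" by (simp add: power2_eq_square algebra_simps)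
  have "cos y \<ge> 1 - (1964 / 10000 * y) / 2" using cos_ge[of y] y2 by linarith
  moreover have "sin y \<ge> 9 / 10 * y"
  proof -
    have "y\<^sup>2 \<le> (1964 / 10000)\<^sup>2" using y by (intro power_mono) auto
    then have "y * y\<^sup>2 \<le> y * (1964 / 10000)\<^sup>2" using y by (intro mult_left_mono) auto
    then have "y ^ 3 \<le> 126 / 1000 * y" using y by (simp add: power2_eq_square power3_eq_cube)
    then show ?thesis using sin_ge[of y] y by linarith
  qed
  ultimately show ?thesis using y by linarith
qed

text \<open>Every inequality required for \<open>euler_ratio_attains\<close> is strict at \<open>\<sigma> = 1\<close> and therefore holds for all \<open>\<sigma>\<close> slightly above \<open>1\<close>.  For
  \<open>k = 8\<close> the angle \<open>pi / k\<close> would be too large for these starting phases.\<close>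
lemma eventually_attains:
  assumes k: "k \<ge> 9"
  shows "\<forall>\<^sub>F \<sigma> in at_right 1. \<exists>\<omega>. (\<forall>p. norm (\<omega> p) = 1) \<and>
    euler_ratio (\<lambda>p. \<omega> p * of_real (real p powr - \<sigma>)) = cis (pi / real k)"
proof -
  define y where "y = pi / real k"
  define s where "s = (if k \<le> 15 then start_small else start_large)"
  define E where "E = head_factor 1 s"
  have s: "s \<in> torus" using start_torus by (simp add: s_def)
  have E2: "(norm E)\<^sup>2 = 2924858953 / 2780505000"
    unfolding cmod_power2 by (simp add: E_def s_def head_factor_start power2_eq_square)
  have q: "Re (cnj E * cis y) > 1014 / 1000"
  proof (cases "k \<le> 15")
    case True
    have "pi / 15 \<le> y" unfolding y_def using k True by (intro divide_left_mono) auto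
    moreover have "y \<le> pi / 9" unfolding y_def using k by (intro divide_left_mono) auto
    ultimately have "2094 / 10000 \<le> y" "y \<le> 3491 / 10000" using pi_approx by auto
    from start_small_numeric[OF this] True show ?thesis by (simp add: E_def s_def head_factor_start)
  next
    case False
    then have "y \<le> pi / 16" unfolding y_def by (intro divide_left_mono) auto
    then have "0 \<le> y" "y \<le> 1964 / 10000" using pi_approx by (auto simp: y_def)
    from start_large_numeric[OF this] False show ?thesis by (simp add: E_def s_def head_factor_start)
  qed
  have lim: "((\<lambda>\<sigma>. head_factor \<sigma> s) \<longlongrightarrow> E) (at_right 1)"
    unfolding E_def by (rule head_factor_tendsto[OF s])
  have e1: "\<forall>\<^sub>F \<sigma> in at_right 1. 2 * (19 / 20) * Re (cnj (head_factor \<sigma> s) * cis y)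
      - 609 / 625 * (19 / 20)\<^sup>2 * (norm (head_factor \<sigma> s))\<^sup>2 > 1"
    by (rule order_tendstoD(1)[where y = "2 * (19 / 20) * Re (cnj E * cis y) - 609 / 625 * (19 / 20)\<^sup>2 * (norm E)\<^sup>2"])
       (intro tendsto_intros lim, unfold E2, unfold power2_eq_square, use q in linarith)
  have e2: "\<forall>\<^sub>F \<sigma> in at_right 1. 2 * Re (cnj (head_factor \<sigma> s) * cis y)
      - 609 / 625 * (norm (head_factor \<sigma> s))\<^sup>2 > 1"
    by (rule order_tendstoD(1)[where y = "2 * Re (cnj E * cis y) - 609 / 625 * (norm E)\<^sup>2"])
       (intro tendsto_intros lim, unfold E2, use q in linarith)
  have e3: "\<forall>\<^sub>F \<sigma> in at_right 1. (norm (head_factor \<sigma> (\<i>, \<i>, \<i>)))\<^sup>2 < (6 / 7)\<^sup>2"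
  proof (rule order_tendstoD(2))
    show "((\<lambda>\<sigma>. (norm (head_factor \<sigma> (\<i>, \<i>, \<i>)))\<^sup>2) \<longlongrightarrow> (norm (head_factor 1 (\<i>, \<i>, \<i>)))\<^sup>2) (at_right 1)"
      by (intro tendsto_intros head_factor_tendsto) auto
    have norm_lf: "(norm (local_factor (\<i> * of_real r)))\<^sup>2 = (1 + (r ^ 3)\<^sup>2) / (1 + r\<^sup>2)\<^sup>2" for r
      unfolding local_factor_imaginary norm_divide power_divide cmod_power2 by simp
    have head: "head_factor 1 (\<i>, \<i>, \<i>) = local_factor (\<i> * of_real (1 / 3)) * local_factor (\<i> * of_real (1 / 5)) * local_factor (\<i> * of_real (1 / 7))"
      by (simp add: head_factor_def powr_minus_divide)
    show "(norm (head_factor 1 (\<i>, \<i>, \<i>)))\<^sup>2 < (6 / 7)\<^sup>2"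
      unfolding head norm_mult power_mult_distrib norm_lf
      by (simp add: power2_eq_square power3_eq_cube)
  qed
  have e4: "\<forall>\<^sub>F \<sigma> in at_right 1. (2 powr - \<sigma>)\<^sup>2 / (1 + 2 powr - \<sigma>) > (33 / 200 :: real)"
  proof (rule order_tendstoD(1))
    show "((\<lambda>\<sigma>. (2 powr - \<sigma>)\<^sup>2 / (1 + 2 powr - \<sigma>)) \<longlongrightarrow> (2 powr - 1)\<^sup>2 / (1 + 2 powr - 1 :: real)) (at_right 1)"
      by (intro tendsto_intros) (auto simp: powr_minus_divide)
    show "33 / 200 < (2 powr - 1)\<^sup>2 / (1 + 2 powr - 1 :: real)"
      by (simp add: powr_minus_divide power2_eq_square)
  qed
  have e5: "\<forall>\<^sub>F \<sigma> in at_right 1. \<sigma> > (1 :: real)" by (rule eventually_at_right_less)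
  from e1 e2 e3 e4 e5 show ?thesis
  proof eventually_elim
    case (elim \<sigma>)
    note tail = euler_ratio_tail_seq[of \<sigma>]
    have "norm (cis y / (head_factor \<sigma> s * euler_ratio (tail_seq \<sigma>)) - 1) < 33 / 200"
    proof (rule start_condition)
      show "head_factor \<sigma> s \<noteq> 0" using s elim by (intro head_factor_nonzero) auto
      show "1 + 609 / 625 * (19 / 20)\<^sup>2 * (norm (head_factor \<sigma> s))\<^sup>2
          < 2 * (19 / 20) * Re (cnj (head_factor \<sigma> s) * cis y)" using elim(1) by linarith
      show "1 + 609 / 625 * (norm (head_factor \<sigma> s))\<^sup>2 < 2 * Re (cnj (head_factor \<sigma> s) * cis y)"
        using elim(2) by linarith
    qed (use elim tail in auto)
    also have "\<dots> < (2 powr - \<sigma>)\<^sup>2 / (1 + 2 powr - \<sigma>)" using elim by simp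
    finally have "norm (cis y / (head_factor \<sigma> s * euler_ratio (tail_seq \<sigma>)) - 1) * (1 + 2 powr - \<sigma>) < (2 powr - \<sigma>)\<^sup>2"
      by (simp add: less_divide_eq add_pos_pos)
    moreover have "norm (head_factor \<sigma> (\<i>, \<i>, \<i>)) < 6 / 7"
      using elim(3) by (rule power2_less_imp_less) simp
    ultimately show ?case
      using euler_ratio_attains[OF elim(5), of "cis y" s] s unfolding y_def by (metis norm_cis)
  qed
qed

section \<open>Zeros of the zeta quotient equation\<close>

text \<open>The values \<open>p powr -s\<close> turned by prescribed phases \<open>\<omega> p\<close>.  The phases \<open>\<omega> p = p powr -(i t)\<close> amount to a vertical
  shift of \<open>s\<close> by \<open>t\<close>.\<close>
abbreviation twist :: "(nat \<Rightarrow> complex) \<Rightarrow> complex \<Rightarrow> nat \<Rightarrow> complex" where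
  "twist \<omega> s \<equiv> (\<lambda>p. \<omega> p * of_nat p powr (- s))"

lemma norm_of_nat_powr: "norm (of_nat p powr (- s) :: complex) = real p powr - Re s"
  by (cases "p = 0") (auto simp: norm_powr_real_powr)

lemma twist_admissible:
  assumes "\<And>p. prime p \<Longrightarrow> norm (\<omega> p) = 1" "Re s \<ge> 1"
  shows "twist \<omega> s \<in> admissible"
  using assms by (auto simp: admissible_def norm_mult norm_of_nat_powr intro!: powr_le_inverse prime_ge_1_nat)

lemma euler_ratio_zeta:
  assumes s: "Re s \<ge> 1"
  shows "zeta (3 * s) \<noteq> 0" "zeta (2 * s) \<noteq> 0"
    "euler_ratio (twist (\<lambda>_. 1) s) = zeta (2 * s) / zeta (3 * s)"
proof -
  let ?P = "\<lambda>j N. \<Prod>p\<in>primes_below N. 1 - of_nat p powr (- (of_nat j * s)) :: complex"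
  have lim: "(\<lambda>N. ?P 2 N * zeta (2 * s)) \<longlonglongrightarrow> 1" "(\<lambda>N. ?P 3 N * zeta (3 * s)) \<longlonglongrightarrow> 1"
    using zeta_euler_product[of "2 * s"] zeta_euler_product[of "3 * s"] s by auto
  show nz: "zeta (2 * s) \<noteq> 0" "zeta (3 * s) \<noteq> 0"
    using lim by (auto simp: tendsto_const_iff)
  have lim2: "(\<lambda>N. ?P 2 N) \<longlonglongrightarrow> 1 / zeta (2 * s)" "(\<lambda>N. ?P 3 N) \<longlonglongrightarrow> 1 / zeta (3 * s)"
    using tendsto_divide[OF lim(1) tendsto_const nz(1)] tendsto_divide[OF lim(2) tendsto_const nz(2)] nz by auto
  have "(\<lambda>N. ?P 3 N / ?P 2 N) \<longlonglongrightarrow> (1 / zeta (3 * s)) / (1 / zeta (2 * s))"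
    by (intro tendsto_divide lim2) (use nz in auto)
  moreover have "?P 3 N / ?P 2 N = partial_ratio N (twist (\<lambda>_. 1) s)" for N
    unfolding partial_ratio_def prod_dividef[symmetric]
  proof (rule prod.cong)
    fix p assume "p \<in> primes_below N"
    then have p: "p \<ge> 2" by (auto simp: primes_below_def prime_ge_2_nat)
    have pw: "of_nat p powr (- (of_nat j * s)) = (of_nat p powr (- s)) ^ j" for j
      using p by (simp add: powr_def exp_of_nat_mult[symmetric] mult_ac)
    have "norm (of_nat p powr (- s) :: complex) < 1"
      unfolding norm_of_nat_powr using p s by (auto intro!: powr_less_one)
    then show "(1 - of_nat p powr (- (of_nat 3 * s))) / (1 - of_nat p powr (- (of_nat 2 * s))) = local_factor (1 * of_nat p powr (- s))"
      unfolding pw by (simp add: local_factor_eq)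
  qed auto
  ultimately have "(\<lambda>N. partial_ratio N (twist (\<lambda>_. 1) s)) \<longlonglongrightarrow> zeta (2 * s) / zeta (3 * s)"
    by simp
  with partial_ratio_tendsto[OF twist_admissible[of "\<lambda>_. 1" s]] s
  show "euler_ratio (twist (\<lambda>_. 1) s) = zeta (2 * s) / zeta (3 * s)"
    using LIMSEQ_unique by auto
qed

lemma twist_shift:
  assumes "prime p"
  shows "of_nat p powr (- (s + \<i> * of_real t)) = cis (- (t * ln (real p))) * (of_nat p powr (- s) :: complex)"
proof -
  have "p > 0" using assms by (rule prime_gt_0_nat)
  then have "of_nat p powr (- (s + \<i> * of_real t)) = exp (- (\<i> * of_real (t * ln (real p)))) * (of_nat p powr (- s) :: complex)"
    by (simp add: powr_def exp_add[symmetric] Ln_of_nat algebra_simps)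
  then show ?thesis by (simp add: cis_conv_exp)
qed

lemma euler_ratio_cong: "(\<And>p. prime p \<Longrightarrow> x p = y p) \<Longrightarrow> euler_ratio x = euler_ratio y"
proof -
  assume "\<And>p. prime p \<Longrightarrow> x p = y p"
  then have "partial_ratio N x = partial_ratio N y" for N
    unfolding partial_ratio_def by (intro prod.cong) (auto simp: primes_below_def)
  then show ?thesis by (simp add: euler_ratio_def)
qed

lemma euler_ratio_shift:
  "euler_ratio (twist (\<lambda>p. cis (- (t * ln (real p)))) s) = euler_ratio (twist (\<lambda>_. 1) (s + \<i> * of_real t))"
  by (rule euler_ratio_cong) (simp only: twist_shift mult_1_left)

abbreviation half_plane :: "complex set" where
  "half_plane \<equiv> {s. Re s > 1}"

lemma holomorphic_euler_ratio_twist: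
  assumes \<omega>: "\<And>p. prime p \<Longrightarrow> norm (\<omega> p) = 1"
  shows "(\<lambda>s. euler_ratio (twist \<omega> s)) holomorphic_on half_plane"
proof (rule holomorphic_uniform_sequence)
  show "open half_plane" by (rule open_halfspace_Re_gt)
  show "(\<lambda>s. partial_ratio N (twist \<omega> s)) holomorphic_on half_plane" for N
    unfolding partial_ratio_def
  proof (rule holomorphic_on_prod)
    fix p assume "p \<in> primes_below N"
    then have p: "prime p" by (simp add: primes_below_def)
    have "(\<lambda>s. twist \<omega> s p) holomorphic_on half_plane"
      using prime_gt_0_nat[OF p] by (intro holomorphic_intros) auto
    moreover have "(\<lambda>s. twist \<omega> s p) ` half_plane \<subseteq> ball 0 1"
    proof (rule image_subsetI)
      fix s assume "s \<in> half_plane"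
      then have "norm (twist \<omega> s p) \<le> 1 / real p"
        using twist_admissible[of \<omega> s] \<omega> p by (auto simp: admissible_def)
      also have "\<dots> < 1" using prime_gt_1_nat[OF p] by simp
      finally show "twist \<omega> s p \<in> ball 0 1" by simp
    qed
    ultimately show "(\<lambda>s. local_factor (twist \<omega> s p)) holomorphic_on half_plane"
      using holomorphic_on_compose_gen[OF _ holomorphic_on_local_factor] by (simp add: o_def)
  qed
  fix s assume "s \<in> half_plane"
  then obtain d where d: "d > 0" "cball s d \<subseteq> half_plane"
    using open_halfspace_Re_gt[of 1] open_contains_cball by blast
  have "uniform_limit (cball s d) (\<lambda>N s. partial_ratio N (twist \<omega> s)) (\<lambda>s. euler_ratio (twist \<omega> s)) sequentially"
    by (rule uniform_limit_compose'[OF uniform_limit_partial_ratio])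
       (use d twist_admissible[OF \<omega>] in force)
  with d show "\<exists>d>0. cball s d \<subseteq> half_plane \<and> uniform_limit (cball s d) (\<lambda>N s. partial_ratio N (twist \<omega> s)) (\<lambda>s. euler_ratio (twist \<omega> s)) sequentially"
    by blast
qed

text \<open>This limit is only used to see that a twisted quotient which takes a value other than \<open>1\<close> is not constant.\<close>
lemma euler_ratio_twist_tendsto_1:
  assumes \<omega>: "\<And>p. prime p \<Longrightarrow> norm (\<omega> p) = 1"
  shows "(\<lambda>n. euler_ratio (twist \<omega> (of_nat (Suc (Suc n))))) \<longlonglongrightarrow> 1"
proof -
  have "uniform_limit {()} (\<lambda>n u. euler_ratio (twist \<omega> (of_nat (Suc (Suc n))))) (\<lambda>u. euler_ratio (\<lambda>_. 0)) sequentially"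
  proof (rule uniform_limit_euler_ratio_compose)
    show "twist \<omega> (of_nat (Suc (Suc n))) \<in> admissible" for n by (rule twist_admissible[OF \<omega>]) auto
    show "(\<lambda>_. 0) \<in> admissible" by (simp add: admissible_def)
    fix p :: nat assume p: "prime p"
    have "(\<lambda>n. twist \<omega> (of_nat (Suc (Suc n))) p) \<longlonglongrightarrow> 0"
    proof (rule Lim_null_comparison)
      show "\<forall>\<^sub>F n in sequentially. norm (twist \<omega> (of_nat (Suc (Suc n))) p) \<le> (1 / 2) ^ Suc (Suc n)"
      proof (rule always_eventually, rule allI)
        fix n
        have "norm (twist \<omega> (of_nat (Suc (Suc n))) p) = real p powr - real (Suc (Suc n))"
          using \<omega>[OF p] by (simp add: norm_mult norm_of_nat_powr del: of_nat_Suc)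
        also have "\<dots> = (1 / real p) ^ Suc (Suc n)"
          using prime_gt_0_nat[OF p] by (simp only: powr_minus powr_realpow of_nat_0_less_iff) (simp add: field_simps)
        also have "\<dots> \<le> (1 / 2) ^ Suc (Suc n)"
          using prime_ge_2_nat[OF p] by (intro power_mono divide_left_mono) auto
        finally show "norm (twist \<omega> (of_nat (Suc (Suc n))) p) \<le> (1 / 2) ^ Suc (Suc n)" .
      qed
      show "(\<lambda>n. (1 / 2 :: real) ^ Suc (Suc n)) \<longlonglongrightarrow> 0"
        by (intro LIMSEQ_Suc LIMSEQ_power_zero) simp
    qed
    then show "uniform_limit {()} (\<lambda>n u. twist \<omega> (of_nat (Suc (Suc n))) p) (\<lambda>u. 0) sequentially"
      by (simp add: uniform_limit_singleton)
  qed
  moreover have "euler_ratio (\<lambda>_. 0) = 1"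
    by (simp add: euler_ratio_def partial_ratio_def local_factor_def)
  ultimately show ?thesis by (simp add: uniform_limit_singleton)
qed

text \<open>Vertical shifts of the zeta quotient converge uniformly to the twisted quotient, which takes the value \<open>Z\<close> at \<open>\<sigma>\<close>
  and is not constant, so by Hurwitz's theorem some shift takes the value \<open>Z\<close> near \<open>\<sigma>\<close>.  Shifting changes
  only the imaginary part.\<close>
lemma zeta_ratio_attains_nearby:
  assumes \<omega>: "\<And>p. prime p \<Longrightarrow> norm (\<omega> p) = 1" and \<sigma>: "\<sigma> > 1" and \<epsilon>: "\<epsilon> > 0"
    and Z: "euler_ratio (twist \<omega> (of_real \<sigma>)) = Z" "Z \<noteq> 1"
  obtains s where "Re s > 1" "\<bar>Re s - \<sigma>\<bar> < \<epsilon>" "zeta (2 * s) / zeta (3 * s) = Z"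
proof -
  obtain t where t: "\<And>p. prime p \<Longrightarrow> (\<lambda>n. cis (- (t n * ln (real p)))) \<longlonglongrightarrow> \<omega> p"
    using kronecker_primes[of \<omega>] \<omega> by blast
  define g where "g s = euler_ratio (twist \<omega> s) - Z" for s
  define F where "F n s = euler_ratio (twist (\<lambda>p. cis (- (t n * ln (real p)))) s) - Z" for n s
  define S where "S = ball (complex_of_real \<sigma>) (min \<epsilon> (\<sigma> - 1))"
  have S: "of_real \<sigma> \<in> S" "open S" "connected S" using \<sigma> \<epsilon> by (auto simp: S_def)
  have SR: "\<bar>Re s - \<sigma>\<bar> < \<epsilon> \<and> Re s > 1" if "s \<in> S" for s
    using that abs_Re_le_cmod[of "s - of_real \<sigma>"] by (auto simp: S_def dist_norm norm_minus_commute)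
  then have Ssub: "S \<subseteq> half_plane" by auto
  have holg: "g holomorphic_on half_plane"
    unfolding g_def by (intro holomorphic_intros holomorphic_euler_ratio_twist \<omega>)
  have unif: "uniform_limit half_plane F g sequentially"
    unfolding F_def g_def
  proof (intro uniform_limit_minus uniform_limit_const uniform_limit_euler_ratio_compose)
    show "twist (\<lambda>p. cis (- (t n * ln (real p)))) s \<in> admissible" if "s \<in> half_plane" for n s
      using that by (intro twist_admissible) auto
    show "twist \<omega> s \<in> admissible" if "s \<in> half_plane" for s
      using that by (intro twist_admissible \<omega>) auto
    fix p :: nat assume p: "prime p"
    show "uniform_limit half_plane (\<lambda>n s. twist (\<lambda>p. cis (- (t n * ln (real p)))) s p) (\<lambda>s. twist \<omega> s p) sequentially"
    proof (rule uniform_limitI)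
      fix e :: real assume "e > 0"
      have "\<forall>\<^sub>F n in sequentially. dist (cis (- (t n * ln (real p)))) (\<omega> p) < e"
        using tendstoD[OF t[OF p] \<open>e > 0\<close>] .
      then show "\<forall>\<^sub>F n in sequentially. \<forall>s\<in>half_plane. dist (twist (\<lambda>p. cis (- (t n * ln (real p)))) s p) (twist \<omega> s p) < e"
      proof eventually_elim
        case (elim n)
        show ?case
        proof
          fix s :: complex assume s: "s \<in> half_plane"
          have "real p powr - Re s \<le> 1 / real p"
            using s prime_ge_1_nat[OF p] by (intro powr_le_inverse) auto
          also have "\<dots> \<le> 1" using prime_ge_1_nat[OF p] by simp
          finally have le: "norm (of_nat p powr (- s) :: complex) \<le> 1" by (simp add: norm_of_nat_powr)
          have "dist (twist (\<lambda>p. cis (- (t n * ln (real p)))) s p) (twist \<omega> s p)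
              = dist (cis (- (t n * ln (real p)))) (\<omega> p) * norm (of_nat p powr (- s) :: complex)"
            by (simp add: dist_norm left_diff_distrib[symmetric] norm_mult)
          also have "\<dots> \<le> dist (cis (- (t n * ln (real p)))) (\<omega> p) * 1"
            by (intro mult_left_mono le) auto
          finally show "dist (twist (\<lambda>p. cis (- (t n * ln (real p)))) s p) (twist \<omega> s p) < e"
            using elim by simp
        qed
      qed
    qed
  qed
  have nonconst: "\<not> g constant_on S"
  proof
    assume "g constant_on S"
    then obtain c where c: "\<And>z. z \<in> S \<Longrightarrow> g z = c" by (auto simp: constant_on_def)
    have "g (of_real \<sigma>) = 0" using Z(1) by (simp add: g_def)
    then have gS: "g z = 0" if "z \<in> S" for z using c[OF that] c[OF S(1)] by simp
    have g0: "g z = 0" if "z \<in> half_plane" for z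
    proof (rule analytic_continuation_open[of S half_plane g "\<lambda>_. 0" z])
      show "open half_plane" by (rule open_halfspace_Re_gt)
      show "connected half_plane" by (intro convex_connected convex_halfspace_Re_gt)
    qed (use S Ssub holg gS that in auto)
    have "(\<lambda>n. g (of_nat (Suc (Suc n)))) \<longlonglongrightarrow> 1 - Z"
      unfolding g_def by (intro tendsto_diff tendsto_const euler_ratio_twist_tendsto_1 \<omega>)
    moreover have "g (of_nat (Suc (Suc n))) = 0" for n by (rule g0) auto
    ultimately show False using Z(2) by (simp add: tendsto_const_iff)
  qed
  have "\<exists>n. \<exists>s\<in>S. F n s = 0"
  proof (rule ccontr)
    assume no: "\<not> ?thesis"
    have "g (of_real \<sigma>) \<noteq> 0"
    proof (rule Hurwitz_no_zeros[of S F g])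
      show "F n holomorphic_on S" for n
        unfolding F_def
        by (intro holomorphic_intros holomorphic_on_subset[OF holomorphic_euler_ratio_twist Ssub]) auto
      show "g holomorphic_on S" using holg Ssub by (rule holomorphic_on_subset)
      show "uniform_limit K F g sequentially" if "compact K" "K \<subseteq> S" for K
        using unif by (rule uniform_limit_on_subset) (use that Ssub in auto)
    qed (use S nonconst no in auto)
    then show False using Z by (simp add: g_def)
  qed
  then obtain n s where s: "s \<in> S" "F n s = 0" by blast
  define s' where "s' = s + \<i> * of_real (t n)"
  have Re: "Re s' = Re s" by (simp add: s'_def)
  have "zeta (2 * s') / zeta (3 * s') = Z"
    using s SR[OF s(1)] euler_ratio_zeta(3)[of s'] euler_ratio_shift[of "t n" s] Re
    by (simp add: F_def s'_def)
  then show ?thesis using that[of s'] SR[OF s(1)] Re by auto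
qed

text \<open>For \<open>k \<ge> 9\<close> the real parts of the zeros are dense in some interval \<open>(1, b)\<close>, which a finite set cannot achieve; this spares
  any control over the size of the vertical shifts.\<close>
theorem theorem3:
  "(\<forall>k::nat. k \<ge> 9 \<longrightarrow>
      infinite {s::complex. Re s > 1 \<and> zeta (2 * s) ^ k + zeta (3 * s) ^ k = 0}) \<and>
   (\<forall>k::nat. 1 \<le> k \<and> k \<le> 5 \<longrightarrow>
      (\<forall>s::complex. Re s > 1 \<longrightarrow> zeta (2 * s) ^ k + zeta (3 * s) ^ k \<noteq> 0))"
proof (intro conjI allI impI)
  fix k :: nat and s :: complex
  assume k: "1 \<le> k \<and> k \<le> 5" and s: "Re s > 1"
  let ?x = "twist (\<lambda>_. 1) s"
  have x: "?x \<in> admissible" using s by (intro twist_admissible) auto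
  have nz: "zeta (2 * s) \<noteq> 0" "zeta (3 * s) \<noteq> 0" and eq: "euler_ratio ?x = zeta (2 * s) / zeta (3 * s)"
    using euler_ratio_zeta[of s] s by auto
  have neq: "(zeta (2 * s) / zeta (3 * s)) ^ k \<noteq> -1"
    using euler_ratio_power_neq_minus_one[OF x, of k] k nz unfolding eq by simp
  show "zeta (2 * s) ^ k + zeta (3 * s) ^ k \<noteq> 0"
  proof
    assume "zeta (2 * s) ^ k + zeta (3 * s) ^ k = 0"
    then have "zeta (2 * s) ^ k = - (zeta (3 * s) ^ k)" by (simp only: eq_neg_iff_add_eq_0)
    with nz neq show False by (simp add: power_divide)
  qed
next
  fix k :: nat assume k: "k \<ge> 9"
  define Z where "Z = cis (pi / real k)"
  let ?A = "{s::complex. Re s > 1 \<and> zeta (2 * s) ^ k + zeta (3 * s) ^ k = 0}"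
  have "Z ^ k = cis (real k * (pi / real k))" unfolding Z_def by (rule Complex.DeMoivre)
  then have Zk: "Z ^ k = -1" using k by simp
  have Z1: "Z \<noteq> 1" using Zk by auto
  obtain b where b: "b > 1" and attains: "\<And>\<sigma>. 1 < \<sigma> \<Longrightarrow> \<sigma> < b \<Longrightarrow> \<exists>\<omega>. (\<forall>p. norm (\<omega> p) = 1) \<and>
    euler_ratio (\<lambda>p. \<omega> p * of_real (real p powr - \<sigma>)) = Z"
    using eventually_attains[OF k] unfolding eventually_at_right_field Z_def by auto
  have dense: "{1<..<b} \<subseteq> closure (Re ` ?A)"
  proof
    fix \<sigma> assume \<sigma>: "\<sigma> \<in> {1<..<b}"
    then obtain \<omega> where \<omega>: "\<And>p. norm (\<omega> p) = 1" "euler_ratio (\<lambda>p. \<omega> p * of_real (real p powr - \<sigma>)) = Z"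
      using attains[of \<sigma>] by auto
    have Z: "euler_ratio (twist \<omega> (of_real \<sigma>)) = Z"
      using \<omega>(2) by (simp add: powr_of_real[symmetric])
    show "\<sigma> \<in> closure (Re ` ?A)"
      unfolding closure_approachable
    proof (intro allI impI)
      fix e :: real assume "e > 0"
      obtain s where s: "Re s > 1" "\<bar>Re s - \<sigma>\<bar> < e" "zeta (2 * s) / zeta (3 * s) = Z"
        using zeta_ratio_attains_nearby[OF \<omega>(1) _ \<open>e > 0\<close> Z Z1] \<sigma> by (metis greaterThanLessThan_iff)
      have nz: "zeta (3 * s) \<noteq> 0" using euler_ratio_zeta(1)[of s] s by simp
      then have "zeta (2 * s) = Z * zeta (3 * s)" using s(3) by (simp add: field_simps)
      then have "s \<in> ?A" using s Zk by (simp add: power_mult_distrib)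
      then show "\<exists>y\<in>Re ` ?A. dist y \<sigma> < e" using s(2) by (auto simp: dist_real_def)
    qed
  qed
  show "infinite ?A"
  proof
    assume "finite ?A"
    then have fin: "finite (Re ` ?A)" by (rule finite_imageI)
    then have "closure (Re ` ?A) = Re ` ?A" by (intro closure_closed finite_imp_closed)
    with dense fin have "finite {1<..<b}" using finite_subset by simp
    with infinite_Ioo[OF b] show False by blast
  qed
qed

end
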